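(* Let $s>0$ and $n\ge1$. Let $G$ be a finite graph, every edge of which has length at least $s$, such that every connected component $C$ of $G$ satisfies $\mathrm{FvsNum}(C)\le1$. Let $N=\min(n+\mathrm{FvsNum}(G),\,2n-1)$. Then for any $n$ agents with monotone (continuous, nonnegative) valuations, there is an $s$-separated allocation $(A_1,\dots,A_n)$ with $v_i(A_i)\ge\mathrm{MMS}_i^{N,s}$ for every $i\in[n]$.
   Context: Cake model: the cake is a finite undirected graph $G$, possibly disconnected, in which every edge is a segment of positive length; points of $G$ are its vertices and the points on its edges. A piece of cake is a finite union of intervals contained in edges, together possibly with some vertices. A piece $X$ is connected if any two points of $X$ can be joined by a path in $G$ that stays inside $X$. Each agent $i$ has a valuation $v_i$ on pieces that is nonnegative, monotone and continuous; in particular, points have value $0$. Distances: $\mathrm{Dist}^G(x,y)$ is the length of a shortest path along the edges, and is $\infty$ if $x$ and $y$ lie in different components. For sets, $\mathrm{Dist}^G(X,Y)=\inf_{x\in X,y\in Y}\mathrm{Dist}^G(x,y)$. Separation: a $k$-partition is $s$-separated if it consists of $k$ pairwise disjoint connected pieces $P_1,\dots,P_k$ with $\mathrm{Dist}^G(P_i,P_j)\ge s$ for $i\ne j$. An $s$-separated allocation is a vector of connected pieces satisfying the same condition. Maximin share: $\mathrm{MMS}_i^{k,s}=\sup\min_{j\in[k]}v_i(P_j)$, where the supremum ranges over $s$-separated $k$-partitions. $\mathrm{FvsNum}(H)$ is the minimum number of vertices whose removal from $H$ leaves an acyclic graph. *)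

theory Defs
  imports "HOL-Analysis.Analysis"
begin

text \<open>A cake: a finite simple undirected graph with vertex set V and edge set E.
  Each undirected edge is stored once, as an ordered pair (u,w) with u \<noteq> w
  (the orientation is an arbitrary bookkeeping choice); len e > 0 is its length.
  A point is either a vertex, or an interior point of an edge e at distance t
  from fst e (0 < t < len e).\<close>

datatype 'v point = Vx 'v | Ep "'v \<times> 'v" real

definition graph_ok :: "'v set \<Rightarrow> ('v \<times> 'v) set \<Rightarrow> (('v \<times> 'v) \<Rightarrow> real) \<Rightarrow> bool" where
  "graph_ok V E len \<longleftrightarrow> finite V \<and> finite E \<and> E \<subseteq> V \<times> V
     \<and> (\<forall>(u,w)\<in>E. u \<noteq> w \<and> (w,u) \<notin> E) \<and> (\<forall>e\<in>E. len e > 0)"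

definition pts :: "'v set \<Rightarrow> ('v \<times> 'v) set \<Rightarrow> (('v \<times> 'v) \<Rightarrow> real) \<Rightarrow> 'v point set" where
  "pts V E len = Vx ` V \<union> {Ep e t | e t. e \<in> E \<and> 0 < t \<and> t < len e}"

definition param :: "(('v \<times> 'v) \<Rightarrow> real) \<Rightarrow> ('v \<times> 'v) \<Rightarrow> real \<Rightarrow> 'v point" where
  "param len e t = (if t \<le> 0 then Vx (fst e) else if len e \<le> t then Vx (snd e) else Ep e t)"

definition finite_union_intervals :: "real set \<Rightarrow> bool" where
  "finite_union_intervals S \<longleftrightarrow> (\<exists>F. finite F \<and> (\<forall>I\<in>F. is_interval I) \<and> S = \<Union>F)"

definition on_edge :: "(('v \<times> 'v) \<Rightarrow> real) \<Rightarrow> ('v \<times> 'v) \<Rightarrow> 'v point set \<Rightarrow> real set" where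
  "on_edge len e X = {t. 0 < t \<and> t < len e \<and> Ep e t \<in> X}"

definition piece :: "'v set \<Rightarrow> ('v \<times> 'v) set \<Rightarrow> (('v \<times> 'v) \<Rightarrow> real) \<Rightarrow> 'v point set \<Rightarrow> bool" where
  "piece V E len X \<longleftrightarrow> X \<subseteq> pts V E len \<and> (\<forall>e\<in>E. finite_union_intervals (on_edge len e X))"

definition plen :: "('v \<times> 'v) set \<Rightarrow> (('v \<times> 'v) \<Rightarrow> real) \<Rightarrow> 'v point set \<Rightarrow> real" where
  "plen E len X = (\<Sum>e\<in>E. measure lborel (on_edge len e X))"

text \<open>Walks along the edges: walk p q L S means there is a path in G from p to q
  of length L whose trace (set of visited points) is S.\<close>
inductive walk :: "'v set \<Rightarrow> ('v \<times> 'v) set \<Rightarrow> (('v \<times> 'v) \<Rightarrow> real)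
    \<Rightarrow> 'v point \<Rightarrow> 'v point \<Rightarrow> real \<Rightarrow> 'v point set \<Rightarrow> bool"
  for V E len where
  walk_nil: "p \<in> pts V E len \<Longrightarrow> walk V E len p p 0 {p}"
| walk_step: "\<lbrakk>e \<in> E; 0 \<le> a; a \<le> len e; 0 \<le> b; b \<le> len e;
      walk V E len (param len e b) r L S\<rbrakk>
    \<Longrightarrow> walk V E len (param len e a) r (\<bar>a - b\<bar> + L)
          (param len e ` {min a b..max a b} \<union> S)"

definition connected_piece :: "'v set \<Rightarrow> ('v \<times> 'v) set \<Rightarrow> (('v \<times> 'v) \<Rightarrow> real) \<Rightarrow> 'v point set \<Rightarrow> bool" where
  "connected_piece V E len X \<longleftrightarrow> piece V E len X \<and>
     (\<forall>p\<in>X. \<forall>q\<in>X. \<exists>L S. walk V E len p q L S \<and> S \<subseteq> X)"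

text \<open>Shortest-path distance (\<infinity> if no path exists).\<close>
definition Dist :: "'v set \<Rightarrow> ('v \<times> 'v) set \<Rightarrow> (('v \<times> 'v) \<Rightarrow> real) \<Rightarrow> 'v point \<Rightarrow> 'v point \<Rightarrow> ereal" where
  "Dist V E len p q = (INF L \<in> {L. \<exists>S. walk V E len p q L S}. ereal L)"

definition DistSet :: "'v set \<Rightarrow> ('v \<times> 'v) set \<Rightarrow> (('v \<times> 'v) \<Rightarrow> real) \<Rightarrow> 'v point set \<Rightarrow> 'v point set \<Rightarrow> ereal" where
  "DistSet V E len X Y = (INF x \<in> X. INF y \<in> Y. Dist V E len x y)"

definition separated :: "'v set \<Rightarrow> ('v \<times> 'v) set \<Rightarrow> (('v \<times> 'v) \<Rightarrow> real) \<Rightarrow> real \<Rightarrow> nat \<Rightarrow> (nat \<Rightarrow> 'v point set) \<Rightarrow> bool" where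
  "separated V E len s k P \<longleftrightarrow>
     (\<forall>j<k. connected_piece V E len (P j)) \<and>
     (\<forall>i<k. \<forall>j<k. i \<noteq> j \<longrightarrow> P i \<inter> P j = {} \<and> DistSet V E len (P i) (P j) \<ge> ereal s)"

definition valuation :: "'v set \<Rightarrow> ('v \<times> 'v) set \<Rightarrow> (('v \<times> 'v) \<Rightarrow> real) \<Rightarrow> ('v point set \<Rightarrow> real) \<Rightarrow> bool" where
  "valuation V E len v \<longleftrightarrow>
     (\<forall>X. piece V E len X \<longrightarrow> v X \<ge> 0) \<and>
     (\<forall>X Y. piece V E len X \<longrightarrow> piece V E len Y \<longrightarrow> X \<subseteq> Y \<longrightarrow> v X \<le> v Y) \<and>
     (\<forall>p\<in>pts V E len. v {p} = 0) \<and>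
     (\<forall>X. piece V E len X \<longrightarrow> (\<forall>\<epsilon>>0. \<exists>\<delta>>0. \<forall>Y. piece V E len Y \<longrightarrow>
          plen E len ((X - Y) \<union> (Y - X)) < \<delta> \<longrightarrow> \<bar>v Y - v X\<bar> < \<epsilon>))"

definition MMS :: "'v set \<Rightarrow> ('v \<times> 'v) set \<Rightarrow> (('v \<times> 'v) \<Rightarrow> real) \<Rightarrow> ('v point set \<Rightarrow> real) \<Rightarrow> nat \<Rightarrow> real \<Rightarrow> real" where
  "MMS V E len v k s = Sup {Min ((\<lambda>j. v (P j)) ` {..<k}) | P. separated V E len s k P}"

definition adj :: "('v \<times> 'v) set \<Rightarrow> 'v \<Rightarrow> 'v \<Rightarrow> bool" where
  "adj E u w \<longleftrightarrow> (u, w) \<in> E \<or> (w, u) \<in> E"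

definition has_cycle :: "'v set \<Rightarrow> ('v \<times> 'v) set \<Rightarrow> bool" where
  "has_cycle W E \<longleftrightarrow> (\<exists>cs. length cs \<ge> 3 \<and> distinct cs \<and> set cs \<subseteq> W \<and>
      (\<forall>i < length cs - 1. adj E (cs ! i) (cs ! Suc i)) \<and> adj E (last cs) (hd cs))"

definition FvsNum :: "'v set \<Rightarrow> ('v \<times> 'v) set \<Rightarrow> nat" where
  "FvsNum W E = (LEAST k. \<exists>S \<subseteq> W. card S = k \<and> \<not> has_cycle (W - S) E)"

definition component :: "'v set \<Rightarrow> ('v \<times> 'v) set \<Rightarrow> 'v \<Rightarrow> 'v set" where
  "component V E v = {w \<in> V. (\<lambda>a b. a \<in> V \<and> b \<in> V \<and> adj E a b)\<^sup>*\<^sup>* v w}"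

end

theory Submission
  imports Defs
begin

text \<open>
  Write $N$ for the number of parts. By compactness every agent has an $s$-separated $N$-partition
  all of whose parts are worth at least her maximin share, so it suffices to choose one part of each
  agent's own partition such that the chosen parts are $s$-separated; no valuation is needed for
  that. Two pieces are at distance at least $s$ iff their open $s/2$-neighbourhoods are disjoint.
  Neighbourhoods that avoid a feedback vertex set are subtrees of a forest, and a finite family of
  subtrees has a member $B$ such that all members meeting $B$ share a common point; hence $B$ meets
  at most one of the pairwise disjoint parts of any other agent.

  If $N = n + f$ with $f$ the feedback vertex number, each agent discards her at most $f$
  neighbourhoods that contain one of $f$ feedback vertices and still has $n$ left; giving out $B$
  and removing what it meets costs every other agent at most one part. If $N = 2n - 1$, take one
  feedback vertex in each component. A set $B$ as above, chosen among those avoiding these vertices,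
  meets at most one more part of each agent, namely the one containing the feedback vertex of its
  component, so every step costs at most two parts. If every remaining set contains a feedback
  vertex, any of them meets at most one part of each other agent.
\<close>

section \<open>Walks and neighbourhoods\<close>

text \<open>The intersection graph of subtrees of a forest is chordal, and the member
  \<open>B\<close> is a simplicial vertex of it. Once the forest is oriented towards its roots, a
  member whose top is lowest will do: any member meeting it contains that top. Neighbourhoods are
  taken open and of radius exactly \<open>s / 2\<close> because this turns the metric condition into
  plain disjointness at the threshold \<open>s\<close> itself, and disjointness is all that the
  selection uses. Being open, they need not have a highest point, so tops are defined relative to
  finitely many points.

  The obstacle to compactness is that pieces may be open, half-open or closed, so that partitions
  have no evident limits. Each connected part is therefore enlarged to a closed set given by a
  combinatorial type and finitely many real parameters, every point of which is approximated by
  points of the part. This loses no value, by monotonicity, and no distance, by approximation;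
  bounded parameters then have convergent subsequences. The distance bound survives the limit
  because it is not strict, and disjointness follows from it because \<open>s\<close> is
  positive.\<close>

locale cake =
  fixes V :: "'v set" and E :: "('v \<times> 'v) set" and len :: "'v \<times> 'v \<Rightarrow> real"
  assumes ok: "graph_ok V E len"
begin

lemma finite_V: "finite V" and finite_E: "finite E"
  using ok by (auto simp: graph_ok_def)

lemma fst_in_V: "e \<in> E \<Longrightarrow> fst e \<in> V" and snd_in_V: "e \<in> E \<Longrightarrow> snd e \<in> V"
  using ok by (auto simp: graph_ok_def)

lemma len_pos: "e \<in> E \<Longrightarrow> 0 < len e"
  using ok by (auto simp: graph_ok_def)

lemma edge_irrefl: "e \<in> E \<Longrightarrow> fst e \<noteq> snd e"
  using ok by (auto simp: graph_ok_def)

lemma edge_asym: "(u, w) \<in> E \<Longrightarrow> (w, u) \<notin> E"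
  using ok by (auto simp: graph_ok_def)

abbreviation "wlk \<equiv> walk V E len"
abbreviation "par \<equiv> param len"

lemma param_in_pts: "e \<in> E \<Longrightarrow> par e a \<in> pts V E len"
  using fst_in_V[of e] snd_in_V[of e] by (cases e) (auto simp: param_def pts_def)

lemma wlk_step:
  "\<lbrakk>e \<in> E; 0 \<le> a; a \<le> len e; 0 \<le> b; b \<le> len e; wlk (par e b) r L S\<rbrakk>
    \<Longrightarrow> wlk (par e a) r (\<bar>a - b\<bar> + L) (par e ` {min a b..max a b} \<union> S)"
  by (rule walk_step)

lemma pts_cases:
  assumes "p \<in> pts V E len"
  obtains (vertex) u where "u \<in> V" "p = Vx u"
  | (edge) e t where "e \<in> E" "0 < t" "t < len e" "p = Ep e t"
  using assms by (auto simp: pts_def)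

lemma param_interior: "0 < t \<Longrightarrow> t < len e \<Longrightarrow> par e t = Ep e t"
  by (auto simp: param_def)

lemma param_0: "par e 0 = Vx (fst e)"
  by (auto simp: param_def)

lemma param_len: "e \<in> E \<Longrightarrow> par e (len e) = Vx (snd e)"
  using len_pos[of e] by (auto simp: param_def)

lemma param_eq_Ep:
  "par e a = Ep e' t \<longleftrightarrow> e = e' \<and> a = t \<and> 0 < a \<and> a < len e"
  by (auto simp: param_def)

lemma param_eq_Vx:
  assumes "e \<in> E" "0 \<le> a" "a \<le> len e"
  shows "par e a = Vx u \<longleftrightarrow> (a = 0 \<and> u = fst e) \<or> (a = len e \<and> u = snd e)"
  using assms len_pos[of e] by (auto simp: param_def)

lemma
  assumes "wlk p q L S"
  shows walk_start: "p \<in> S" and walk_pts: "S \<subseteq> pts V E len"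
    and walk_nonneg: "0 \<le> L"
proof -
  have "p \<in> S \<and> S \<subseteq> pts V E len \<and> 0 \<le> L"
    using assms
  proof induction
    case (walk_step e a b r L S)
    have "par e a \<in> par e ` {min a b..max a b}" by auto
    moreover have "par e ` {min a b..max a b} \<subseteq> pts V E len"
      using param_in_pts[OF walk_step(1)] by blast
    ultimately show ?case using walk_step.IH by auto
  qed auto
  then show "p \<in> S" "S \<subseteq> pts V E len" "0 \<le> L" by auto
qed

lemma walk_append:
  assumes "wlk p q L S" "wlk q r L' S'"
  shows "wlk p r (L + L') (S \<union> S')"
  using assms
proof induction
  case (walk_nil p)
  then show ?case using walk_start[OF walk_nil(2)] by (simp add: insert_absorb)
next
  case (walk_step e a b q L S)
  then show ?case
    using wlk_step[OF walk_step(1-5) walk_step.IH[OF walk_step.prems]]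
    by (simp add: add.assoc Un_assoc)
qed

lemma walk_seg:
  assumes "e \<in> E" "0 \<le> a" "a \<le> len e" "0 \<le> b" "b \<le> len e"
  shows "wlk (par e a) (par e b) \<bar>a - b\<bar> (par e ` {min a b..max a b})"
proof -
  have "par e b \<in> par e ` {min a b..max a b}" by auto
  then show ?thesis
    using wlk_step[OF assms walk_nil[OF param_in_pts[OF assms(1)]]]
    by (simp add: insert_absorb)
qed

lemma walk_rev: "wlk p q L S \<Longrightarrow> wlk q p L S"
proof (induction rule: walk.induct)
  case (walk_nil p)
  then show ?case by (rule walk.walk_nil)
next
  case (walk_step e a b r L S)
  have "wlk (par e b) (par e a) \<bar>a - b\<bar> (par e ` {min a b..max a b})"
    using walk_seg[of e b a] walk_step(1-5)
    by (simp add: min.commute max.commute abs_minus_commute)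
  from walk_append[OF walk_step.IH this] show ?case
    by (simp add: add.commute Un_commute)
qed

lemma walk_split_trace:
  assumes "wlk p q L S" "x \<in> S"
  shows "\<exists>L1 L2 S1 S2. wlk p x L1 S1 \<and> wlk x q L2 S2 \<and> L1 + L2 = L \<and> S1 \<subseteq> S \<and> S2 \<subseteq> S"
  using assms
proof induction
  case (walk_nil p)
  then show ?case using walk.walk_nil[OF walk_nil(1)] by fastforce
next
  case (walk_step e a b r L S)
  show ?case
  proof (cases "x \<in> S")
    case True
    then obtain L1 L2 S1 S2 where "wlk (par e b) x L1 S1" "wlk x r L2 S2" "L1 + L2 = L"
      "S1 \<subseteq> S" "S2 \<subseteq> S" using walk_step.IH by blast
    then show ?thesis
      using wlk_step[OF walk_step(1-5), of x L1 S1]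
      by (intro exI[of _ "\<bar>a - b\<bar> + L1"] exI[of _ L2]
          exI[of _ "par e ` {min a b..max a b} \<union> S1"] exI[of _ S2]) auto
  next
    case False
    then obtain c where c: "x = par e c" "min a b \<le> c" "c \<le> max a b"
      using walk_step.prems by auto
    have c': "0 \<le> c" "c \<le> len e" using c(2,3) walk_step(2-5) by auto
    have "wlk (par e a) x \<bar>a - c\<bar> (par e ` {min a c..max a c})"
      using walk_seg[of e a c] walk_step(1-3) c' c(1) by auto
    moreover have "wlk x r (\<bar>c - b\<bar> + L) (par e ` {min c b..max c b} \<union> S)"
      using wlk_step[OF walk_step(1) c' walk_step(4-6)] c(1) by auto
    moreover have "\<bar>a - c\<bar> + (\<bar>c - b\<bar> + L) = \<bar>a - b\<bar> + L" using c by auto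
    moreover have "{min a c..max a c} \<subseteq> {min a b..max a b}"
      "{min c b..max c b} \<subseteq> {min a b..max a b}" using c by auto
    ultimately show ?thesis by (meson Un_mono image_mono le_supI1 order_refl)
  qed
qed

text \<open>Needed at half the length of a walk: the midpoint of a walk shorter than
  \<open>s\<close> lies within \<open>s / 2\<close> of both ends.\<close>

lemma walk_split_length:
  assumes "wlk p q L S" "0 \<le> l" "l \<le> L"
  shows "\<exists>x S1 S2. wlk p x l S1 \<and> wlk x q (L - l) S2"
  using assms
proof (induction arbitrary: l)
  case (walk_nil p)
  then show ?case using walk.walk_nil[OF walk_nil(1)] by fastforce
next
  case (walk_step e a b r L S)
  show ?case
  proof (cases "l \<le> \<bar>a - b\<bar>")
    case True
    define c where "c = (if a \<le> b then a + l else a - l)"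
    have c: "0 \<le> c" "c \<le> len e" "\<bar>a - c\<bar> = l" "\<bar>c - b\<bar> = \<bar>a - b\<bar> - l"
      using True walk_step(2-5) walk_step.prems by (auto simp: c_def)
    show ?thesis
      using walk_seg[OF walk_step(1-3) c(1,2)] c
        wlk_step[OF walk_step(1) c(1,2) walk_step(4-6)]
      by (metis add_diff_eq diff_add_eq)
  next
    case False
    then obtain x S1 S2 where "wlk (par e b) x (l - \<bar>a - b\<bar>) S1"
      "wlk x r (L - (l - \<bar>a - b\<bar>)) S2"
      using walk_step.IH[of "l - \<bar>a - b\<bar>"] walk_step.prems by auto
    then show ?thesis
      using wlk_step[OF walk_step(1-5), of x "l - \<bar>a - b\<bar>" S1]
      by (metis add.commute diff_add_cancel diff_diff_eq2 add_diff_eq)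
  qed
qed

text \<open>The connectedness half of \<open>connected_piece\<close>, kept apart because
  neighbourhoods are only used through their connectedness and are never shown to satisfy
  \<open>piece\<close>.\<close>

definition linked :: "'v point set \<Rightarrow> bool" where
  "linked X \<longleftrightarrow> (\<forall>p\<in>X. \<forall>q\<in>X. \<exists>L S. wlk p q L S \<and> S \<subseteq> X)"

lemma connected_piece_alt: "connected_piece V E len X \<longleftrightarrow> piece V E len X \<and> linked X"
  by (simp add: connected_piece_def linked_def)

definition nbhd :: "real \<Rightarrow> 'v point set \<Rightarrow> 'v point set" where
  "nbhd d P = {q. \<exists>p\<in>P. \<exists>L S. wlk p q L S \<and> L < d}"

text \<open>A point visited by a walk of length less than \<open>d\<close> from \<open>P\<close> is
  itself reached from \<open>P\<close> by a walk of length less than \<open>d\<close>. So such walks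
  stay inside the neighbourhood, and two of them are joined through \<open>P\<close>.\<close>

lemma linked_nbhd:
  assumes "linked P" "0 < d"
  shows "linked (nbhd d P)"
proof -
  have sub: "S \<subseteq> nbhd d P" if pq: "wlk p q L S" "p \<in> P" "L < d" for p q L S
  proof
    fix x assume "x \<in> S"
    then obtain L1 L2 S1 S2 where "wlk p x L1 S1" "wlk x q L2 S2" "L1 + L2 = L"
      using walk_split_trace[OF pq(1)] by blast
    moreover from this have "L1 < d" using walk_nonneg[of x q L2 S2] pq(3) by linarith
    ultimately show "x \<in> nbhd d P" using pq(2) by (auto simp: nbhd_def)
  qed
  have P: "P \<subseteq> nbhd d P"
  proof
    fix p assume p: "p \<in> P"
    then have "p \<in> pts V E len" using assms(1) walk_start walk_pts by (meson linked_def subsetD)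
    then show "p \<in> nbhd d P" using p walk_nil assms(2) by (force simp: nbhd_def)
  qed
  show ?thesis unfolding linked_def
  proof (intro ballI)
    fix x y assume "x \<in> nbhd d P" "y \<in> nbhd d P"
    then obtain p q L1 L2 S1 S2 where *: "p \<in> P" "q \<in> P" "wlk p x L1 S1" "wlk q y L2 S2"
      "L1 < d" "L2 < d" by (auto simp: nbhd_def)
    obtain L S where "wlk p q L S" "S \<subseteq> P" using assms(1) * by (meson linked_def)
    then have "wlk x y (L1 + (L + L2)) (S1 \<union> (S \<union> S2))"
      using * by (intro walk_append[OF walk_rev walk_append])
    moreover have "S1 \<union> (S \<union> S2) \<subseteq> nbhd d P"
      using sub * \<open>S \<subseteq> P\<close> P by blast
    ultimately show "\<exists>L S. wlk x y L S \<and> S \<subseteq> nbhd d P" by blast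
  qed
qed

lemma DistSet_ge_iff:
  "DistSet V E len X Y \<ge> ereal s \<longleftrightarrow> (\<forall>p\<in>X. \<forall>q\<in>Y. \<forall>L S. wlk p q L S \<longrightarrow> s \<le> L)"
  by (auto simp: DistSet_def Dist_def le_INF_iff)

text \<open>A walk shorter than \<open>s\<close> has its midpoint in both neighbourhoods;
  conversely, a common point yields two walks shorter than \<open>s / 2\<close> whose concatenation
  is shorter than \<open>s\<close>.\<close>

lemma nbhd_disjoint_iff:
  "nbhd (s / 2) X \<inter> nbhd (s / 2) Y = {} \<longleftrightarrow> DistSet V E len X Y \<ge> ereal s"
proof
  assume disj: "nbhd (s / 2) X \<inter> nbhd (s / 2) Y = {}"
  show "DistSet V E len X Y \<ge> ereal s" unfolding DistSet_ge_iff
  proof (intro ballI allI impI, rule ccontr)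
    fix p q L S assume *: "p \<in> X" "q \<in> Y" "wlk p q L S" "\<not> s \<le> L"
    obtain x S1 S2 where "wlk p x (L / 2) S1" "wlk x q (L - L / 2) S2"
      using walk_split_length[OF *(3), of "L / 2"] walk_nonneg[OF *(3)] by auto
    then have "x \<in> nbhd (s / 2) X" "x \<in> nbhd (s / 2) Y"
      using * walk_rev[of x q] by (force simp: nbhd_def)+
    then show False using disj by blast
  qed
next
  assume far: "DistSet V E len X Y \<ge> ereal s"
  have False if x: "x \<in> nbhd (s / 2) X" "x \<in> nbhd (s / 2) Y" for x
  proof -
    obtain p q L1 L2 S1 S2 where *: "p \<in> X" "q \<in> Y" "wlk p x L1 S1" "wlk q x L2 S2"
      "L1 < s / 2" "L2 < s / 2" using x by (auto simp: nbhd_def)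
    have "s \<le> L1 + L2"
      using far walk_append[OF *(3) walk_rev[OF *(4)]] *(1,2) by (auto simp: DistSet_ge_iff)
    then show False using * by linarith
  qed
  then show "nbhd (s / 2) X \<inter> nbhd (s / 2) Y = {}" by blast
qed

text \<open>A common point would be joined to itself by a walk of length 0, so a positive distance
  already implies disjointness.\<close>

lemma separated_iff:
  assumes "0 < s"
  shows "separated V E len s k P \<longleftrightarrow>
     (\<forall>j<k. connected_piece V E len (P j)) \<and>
     (\<forall>i<k. \<forall>j<k. i \<noteq> j \<longrightarrow> DistSet V E len (P i) (P j) \<ge> ereal s)"
proof -
  have "X \<inter> Y = {}" if "X \<subseteq> pts V E len" "DistSet V E len X Y \<ge> ereal s" for X Y
    using that walk_nil assms by (fastforce simp: DistSet_ge_iff)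
  then show ?thesis
    unfolding separated_def connected_piece_def piece_def by meson
qed

end

section \<open>Families of subtrees of a forest\<close>

lemma has_cycle_mono: "has_cycle W E \<Longrightarrow> W \<subseteq> W' \<Longrightarrow> has_cycle W' E"
  unfolding has_cycle_def by (meson subset_trans)

text \<open>The first vertex of a longest path is a leaf: by maximality all its neighbours lie on
  the path, and any of them other than the second vertex would close a cycle.\<close>

lemma acyclic_leaf:
  assumes "finite W" "W \<noteq> {}" "\<not> has_cycle W E" and irr: "\<And>u. \<not> adj E u u"
  shows "\<exists>u\<in>W. \<forall>x\<in>W. \<forall>y\<in>W. adj E u x \<longrightarrow> adj E u y \<longrightarrow> x = y"
proof (rule ccontr)
  assume "\<not> ?thesis"
  then have two: "\<exists>x\<in>W. \<exists>y\<in>W. adj E u x \<and> adj E u y \<and> x \<noteq> y" if "u \<in> W" for u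
    using that by blast
  define path where "path cs \<longleftrightarrow> cs \<noteq> [] \<and> distinct cs \<and> set cs \<subseteq> W \<and>
      (\<forall>i < length cs - 1. adj E (cs ! i) (cs ! Suc i))" for cs
  obtain w where "w \<in> W" using assms(2) by blast
  then have "path [w]" by (simp add: path_def)
  moreover have "\<forall>cs. path cs \<longrightarrow> length cs < Suc (card W)"
    using assms(1) by (auto simp: path_def less_Suc_eq_le intro!: card_mono
        simp flip: distinct_card)
  ultimately obtain cs where cs: "path cs" and maxl: "\<And>ds. path ds \<Longrightarrow> length ds \<le> length cs"
    using ex_has_greatest_nat[of path "[w]" length "Suc (card W)"] by blast
  define u where "u = cs ! 0"
  have len: "0 < length cs" using cs by (simp add: path_def)
  have uW: "u \<in> W" using cs by (auto simp: path_def u_def)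
  have mem: "x \<in> set cs" if "x \<in> W" "adj E u x" for x
  proof (rule ccontr)
    assume x: "x \<notin> set cs"
    have "adj E ((x # cs) ! i) ((x # cs) ! Suc i)" if "i < length (x # cs) - 1" for i
    proof (cases i)
      case 0
      then show ?thesis using \<open>adj E u x\<close> by (auto simp: u_def adj_def)
    next
      case (Suc m)
      then show ?thesis using cs that by (auto simp: path_def)
    qed
    then have "path (x # cs)" using cs x that by (auto simp: path_def)
    then show False using maxl by fastforce
  qed
  have short: "i = 1" if i: "i < length cs" "adj E u (cs ! i)" for i
  proof (rule ccontr)
    assume "i \<noteq> 1"
    moreover have "i \<noteq> 0" using i irr by (metis u_def)
    ultimately have "2 \<le> i" by linarith
    \<comment> \<open>The part of the path from \<open>u\<close> to \<open>cs ! i\<close> has at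
      least three vertices, as \<open>has_cycle\<close> demands, precisely because
      \<open>2 \<le> i\<close>.\<close>
    let ?c = "take (Suc i) cs"
    have "length ?c \<ge> 3" using \<open>2 \<le> i\<close> i by simp
    moreover have "distinct ?c" "set ?c \<subseteq> W"
      using cs by (auto simp: path_def dest: in_set_takeD)
    moreover have "\<forall>m < length ?c - 1. adj E (?c ! m) (?c ! Suc m)"
      using cs i by (auto simp: path_def)
    moreover have "adj E (last ?c) (hd ?c)"
    proof -
      have "last ?c = cs ! i" using i by (simp add: take_Suc_conv_app_nth)
      moreover have "hd ?c = u" using len by (simp add: u_def hd_conv_nth)
      ultimately show ?thesis using i by (auto simp: adj_def)
    qed
    ultimately have "has_cycle W E" unfolding has_cycle_def by blast
    then show False using assms(3) by blast
  qed
  obtain x y where "x \<in> W" "y \<in> W" "adj E u x" "adj E u y" "x \<noteq> y" using two uW by blast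
  then show False using mem short by (metis in_set_conv_nth)
qed

text \<open>Leaves are removed one after another and ranked in the order of removal. When a vertex
  is removed, at most one of its neighbours is left, and only the neighbours left receive a higher
  rank.\<close>

lemma acyclic_rank:
  assumes "finite W" "\<not> has_cycle W E" and irr: "\<And>u. \<not> adj E u u"
  shows "\<exists>\<rho>::'v \<Rightarrow> nat. inj_on \<rho> W \<and>
    (\<forall>u\<in>W. \<forall>x\<in>W. \<forall>y\<in>W. adj E u x \<longrightarrow> adj E u y \<longrightarrow> \<rho> u < \<rho> x \<longrightarrow> \<rho> u < \<rho> y \<longrightarrow> x = y)"
  using assms(1,2)
proof (induction "card W" arbitrary: W)
  case 0
  then show ?case by simp
next
  case (Suc m)
  have "W \<noteq> {}" using Suc.hyps by auto
  from acyclic_leaf[OF Suc.prems(1) this Suc.prems(2) irr]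
  obtain u where u: "u \<in> W" "\<forall>x\<in>W. \<forall>y\<in>W. adj E u x \<longrightarrow> adj E u y \<longrightarrow> x = y"
    by (elim bexE)
  have "m = card (W - {u})" using Suc.hyps(2) Suc.prems(1) u(1) by simp
  moreover have "finite (W - {u})" using Suc.prems(1) by simp
  moreover have "\<not> has_cycle (W - {u}) E"
    using has_cycle_mono[of "W - {u}" E W] Suc.prems(2) by (meson Diff_subset)
  ultimately obtain \<rho> :: "'v \<Rightarrow> nat" where \<rho>: "inj_on \<rho> (W - {u})"
    "\<forall>v\<in>W - {u}. \<forall>x\<in>W - {u}. \<forall>y\<in>W - {u}.
      adj E v x \<longrightarrow> adj E v y \<longrightarrow> \<rho> v < \<rho> x \<longrightarrow> \<rho> v < \<rho> y \<longrightarrow> x = y"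
    using Suc.hyps(1)[of "W - {u}"] by metis
  define \<sigma> where "\<sigma> x = (if x = u then 0 else Suc (\<rho> x))" for x
  have "inj_on \<sigma> W" using \<rho>(1) by (auto simp: \<sigma>_def inj_on_def)
  moreover have "\<forall>v\<in>W. \<forall>x\<in>W. \<forall>y\<in>W.
      adj E v x \<longrightarrow> adj E v y \<longrightarrow> \<sigma> v < \<sigma> x \<longrightarrow> \<sigma> v < \<sigma> y \<longrightarrow> x = y"
  proof (intro ballI impI)
    fix v x y
    assume *: "v \<in> W" "x \<in> W" "y \<in> W" "adj E v x" "adj E v y" "\<sigma> v < \<sigma> x" "\<sigma> v < \<sigma> y"
    show "x = y"
    proof (cases "v = u")
      case True
      then show ?thesis using * u(2) by blast
    next
      case False
      then have "x \<noteq> u" "y \<noteq> u" "\<rho> v < \<rho> x" "\<rho> v < \<rho> y"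
        using * by (auto simp: \<sigma>_def split: if_splits)
      then show ?thesis using * False \<rho>(2) by blast
    qed
  qed
  ultimately show ?case by blast
qed

context cake
begin

lemma adj_irrefl: "\<not> adj E u u"
  using edge_irrefl by (force simp: adj_def)

lemma rank_exists:
  assumes "\<not> has_cycle (V - Z) E"
  obtains \<rho> :: "'v \<Rightarrow> real" where "inj_on \<rho> V"
    "\<And>u x y. u \<in> V - Z \<Longrightarrow> x \<in> V \<Longrightarrow> y \<in> V \<Longrightarrow> adj E u x \<Longrightarrow> adj E u y \<Longrightarrow>
       \<rho> u < \<rho> x \<Longrightarrow> \<rho> u < \<rho> y \<Longrightarrow> x = y"
proof -
  from acyclic_rank[OF finite_Diff[OF finite_V] assms adj_irrefl]
  obtain \<sigma> :: "'v \<Rightarrow> nat" where \<sigma>: "inj_on \<sigma> (V - Z)"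
    "\<forall>u\<in>V - Z. \<forall>x\<in>V - Z. \<forall>y\<in>V - Z.
       adj E u x \<longrightarrow> adj E u y \<longrightarrow> \<sigma> u < \<sigma> x \<longrightarrow> \<sigma> u < \<sigma> y \<longrightarrow> x = y"
    by (elim exE conjE)
  obtain \<tau> :: "'v \<Rightarrow> nat" where \<tau>: "inj_on \<tau> V"
    using finite_imp_inj_to_nat_seg[OF finite_V] by blast
  \<comment> \<open>Vertices of \<open>Z\<close> go below all others, so none of them is the parent
    of a vertex outside \<open>Z\<close>. The injection \<open>\<tau>\<close> keeps all ranks
    distinct, so that no edge, not even one at \<open>Z\<close>, is level.\<close>
  define \<rho> where "\<rho> x = (if x \<in> Z then - 1 - real (\<tau> x) else real (\<sigma> x))" for x
  show ?thesis
  proof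
    show "inj_on \<rho> V"
      using \<sigma>(1) \<tau> by (auto simp: \<rho>_def inj_on_def)
    fix u x y
    assume *: "u \<in> V - Z" "x \<in> V" "y \<in> V" "adj E u x" "adj E u y" "\<rho> u < \<rho> x" "\<rho> u < \<rho> y"
    then have "x \<notin> Z" "y \<notin> Z" by (auto simp: \<rho>_def split: if_splits)
    then show "x = y" using * \<sigma>(2) by (auto simp: \<rho>_def)
  qed
qed

end

text \<open>A ranking of the vertices in which each vertex outside \<open>Z\<close> has at most one neighbour of higher
  rank, its parent: this orients the forest towards its roots. It is extended linearly to the edges
  as a height function.\<close>

locale ranked_cake = cake +
  fixes Z :: "'a set" and \<rho> :: "'a \<Rightarrow> real"
  assumes inj: "inj_on \<rho> V"
    and parent_unique: "\<And>u x y. u \<in> V - Z \<Longrightarrow> x \<in> V \<Longrightarrow> y \<in> V \<Longrightarrow> adj E u x \<Longrightarrow> adj E u y \<Longrightarrow>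
       \<rho> u < \<rho> x \<Longrightarrow> \<rho> u < \<rho> y \<Longrightarrow> x = y"
begin

section \<open>Ascents in the oriented forest\<close>

definition slope :: "'a \<times> 'a \<Rightarrow> real" where
  "slope e = (\<rho> (snd e) - \<rho> (fst e)) / len e"

definition ht :: "'a point \<Rightarrow> real" where
  "ht p = (case p of Vx u \<Rightarrow> \<rho> u | Ep e t \<Rightarrow> \<rho> (fst e) + slope e * t)"

lemma ht_param:
  "e \<in> E \<Longrightarrow> 0 \<le> a \<Longrightarrow> a \<le> len e \<Longrightarrow> ht (par e a) = \<rho> (fst e) + slope e * a"
  using len_pos[of e] by (auto simp: ht_def param_def slope_def)

lemma slope_nonzero: "e \<in> E \<Longrightarrow> slope e \<noteq> 0"
  using len_pos[of e] edge_irrefl[of e] inj fst_in_V[of e] snd_in_V[of e]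
  by (auto simp: slope_def inj_on_def)

text \<open>A single ascent along one edge with its trace in \<open>B\<close>. For \<open>B\<close>
  avoiding \<open>Z\<close>, the closure \<open>(up B)\<^sup>*\<^sup>*\<close> plays the part of the
  ancestor order of the rooted forest, restricted to \<open>B\<close>.\<close>

definition up :: "'a point set \<Rightarrow> 'a point \<Rightarrow> 'a point \<Rightarrow> bool" where
  "up B p q \<longleftrightarrow> (\<exists>e a b. e \<in> E \<and> 0 \<le> a \<and> a \<le> len e \<and> 0 \<le> b \<and> b \<le> len e \<and>
     p = par e a \<and> q = par e b \<and> ht p \<le> ht q \<and> par e ` {min a b..max a b} \<subseteq> B)"

lemma up_param:
  assumes "e \<in> E" "0 \<le> a" "a \<le> len e" "0 \<le> b" "b \<le> len e"
    and "ht (par e a) \<le> ht (par e b)" "par e ` {min a b..max a b} \<subseteq> B"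
  shows "up B (par e a) (par e b)"
  unfolding up_def
  by (intro exI[of _ e] exI[of _ a] exI[of _ b] conjI) (use assms in simp_all)

lemma up_mem: "up B p q \<Longrightarrow> p \<in> B \<and> q \<in> B"
  by (auto simp: up_def)

text \<open>No edge is level, so an ascent without gain in height does not move; this makes the
  closure of \<open>up\<close> antisymmetric.\<close>

lemma up_ht: "up B p q \<Longrightarrow> ht p \<le> ht q \<and> (ht p = ht q \<longrightarrow> p = q)"
  using slope_nonzero by (auto simp: up_def ht_param)

lemma ups_ht: "(up B)\<^sup>*\<^sup>* p q \<Longrightarrow> ht p \<le> ht q \<and> (ht p = ht q \<longrightarrow> p = q)"
proof (induction rule: rtranclp_induct)
  case (step y z)
  then show ?case using up_ht[of B y z] by auto
qed simp

text \<open>Height is linear on an edge, so one higher point on it forces the opposite end to be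
  higher than \<open>u\<close>. For \<open>u\<close> outside \<open>Z\<close> that end is the parent
  of \<open>u\<close>.\<close>

lemma rising_edge:
  assumes "e \<in> E" "0 \<le> a" "a \<le> len e" "0 \<le> b" "b \<le> len e"
    and "par e a = Vx u" "\<rho> u < ht (par e b)"
  shows "\<exists>x\<in>V. \<rho> u < \<rho> x \<and> (e = (u, x) \<and> a = 0 \<or> e = (x, u) \<and> a = len e)"
proof -
  have l: "0 < len e" using len_pos assms by blast
  have h: "ht (par e b) = \<rho> (fst e) + slope e * b" using assms ht_param by blast
  consider "a = 0" "u = fst e" | "a = len e" "u = snd e"
    using assms param_eq_Vx[of e a u] by auto
  then show ?thesis
  proof cases
    case 1
    then have "0 < slope e * b" using h assms by simp
    then have "0 < slope e" using assms(4) by (simp add: zero_less_mult_iff)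
    then have "\<rho> u < \<rho> (snd e)" using l 1 by (simp add: slope_def zero_less_divide_iff)
    then show ?thesis using 1 snd_in_V[OF assms(1)] by (metis prod.collapse)
  next
    case 2
    have "\<rho> (snd e) = \<rho> (fst e) + slope e * len e" using l by (simp add: slope_def)
    then have "0 < slope e * (b - len e)" using h assms 2 by (simp add: algebra_simps)
    then have "slope e < 0" using assms(5) by (simp add: zero_less_mult_iff)
    then have "\<rho> u < \<rho> (fst e)" using l 2 by (simp add: slope_def divide_less_0_iff)
    then show ?thesis using 2 fst_in_V[OF assms(1)] by (metis prod.collapse)
  qed
qed

text \<open>Above a point outside \<open>Z\<close> there is only one way up.\<close>

lemma up_linear:
  assumes "up B p q" "up B' p q'" and Z: "p \<notin> Vx ` Z"
  shows "(q \<in> B' \<and> up B' q q') \<or> (q' \<in> B \<and> up B q' q)"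
proof (cases "q = p \<or> q' = p")
  case True
  then show ?thesis using assms up_mem by blast
next
  case False
  obtain e a b where e: "e \<in> E" "0 \<le> a" "a \<le> len e" "0 \<le> b" "b \<le> len e"
    "p = par e a" "q = par e b" "par e ` {min a b..max a b} \<subseteq> B"
    using assms(1) by (auto simp: up_def)
  obtain e' a' b' where e': "e' \<in> E" "0 \<le> a'" "a' \<le> len e'" "0 \<le> b'" "b' \<le> len e'"
    "p = par e' a'" "q' = par e' b'" "par e' ` {min a' b'..max a' b'} \<subseteq> B'"
    using assms(2) by (auto simp: up_def)
  have lt: "ht p < ht q" "ht p < ht q'"
    using False assms(1,2) up_ht by (metis order_le_less)+
  \<comment> \<open>At a vertex both edges lead to the same parent, and the graph is simple; at an
    interior point the edge is determined by the point.\<close>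
  have "e = e' \<and> a = a'"
  proof (cases "p \<in> Vx ` V")
    case True
    then obtain u where u: "p = Vx u" "u \<in> V - Z" using Z by blast
    have "ht p = \<rho> u" using u by (simp add: ht_def)
    then obtain x x' where "x \<in> V" "\<rho> u < \<rho> x" "e = (u, x) \<and> a = 0 \<or> e = (x, u) \<and> a = len e"
      and "x' \<in> V" "\<rho> u < \<rho> x'" "e' = (u, x') \<and> a' = 0 \<or> e' = (x', u) \<and> a' = len e'"
      using rising_edge[OF e(1-5), of u] rising_edge[OF e'(1-5), of u] u e(6,7) e'(6,7) lt
      by metis
    moreover from this have "x = x'"
      using parent_unique[of u x x'] u e(1) e'(1) by (auto simp: adj_def)
    ultimately show ?thesis using edge_asym e(1) e'(1) edge_irrefl by fastforce
  next
    case False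
    then obtain f t where "p = Ep f t"
      using e(1,6) param_in_pts[OF e(1), of a] by (auto simp: pts_def)
    then show ?thesis using e(6) e'(6) param_eq_Ep by metis
  qed
  then have [simp]: "e' = e" "a' = a" by auto
  \<comment> \<open>Both targets lie on the ascending side of \<open>a\<close>, so one of
    \<open>b\<close> and \<open>b'\<close> lies between \<open>a\<close> and the other.\<close>
  have m: "0 < slope e * (b - a)" "0 < slope e * (b' - a)"
    using lt e e' by (auto simp: ht_param algebra_simps)
  have up1: "q \<in> B' \<and> up B' q q'"
    if "ht q \<le> ht q'" "min a b' \<le> b" "b \<le> max a b'"
  proof -
    have "par e ` {min b b'..max b b'} \<subseteq> par e ` {min a b'..max a b'}"
      using that by (intro image_mono) auto
    then have "par e ` {min b b'..max b b'} \<subseteq> B'" using e'(8) by auto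
    moreover from this have "q \<in> B'" using e(7) by auto
    moreover have "up B' q q'" unfolding up_def
      by (intro exI[of _ e] exI[of _ b] exI[of _ b'] conjI)
        (use calculation that(1) e(1-7) e'(1-7) in simp_all)
    ultimately show ?thesis by blast
  qed
  have up2: "q' \<in> B \<and> up B q' q"
    if "ht q' \<le> ht q" "min a b \<le> b'" "b' \<le> max a b"
  proof -
    have "par e ` {min b' b..max b' b} \<subseteq> par e ` {min a b..max a b}"
      using that by (intro image_mono) auto
    then have "par e ` {min b' b..max b' b} \<subseteq> B" using e(8) by auto
    moreover from this have "q' \<in> B" using e'(7) by auto
    moreover have "up B q' q" unfolding up_def
      by (intro exI[of _ e] exI[of _ b'] exI[of _ b] conjI)
        (use calculation that(1) e(1-7) e'(1-7) in simp_all)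
    ultimately show ?thesis by blast
  qed
  have hq: "ht q = \<rho> (fst e) + slope e * b" "ht q' = \<rho> (fst e) + slope e * b'"
    using e e' by (auto simp: ht_param)
  show ?thesis
  proof (cases "0 < slope e")
    case True
    then have "a < b" "a < b'" using m by (auto simp: zero_less_mult_iff)
    moreover have "ht q \<le> ht q' \<longleftrightarrow> b \<le> b'" "ht q' \<le> ht q \<longleftrightarrow> b' \<le> b"
      using True hq by auto
    ultimately show ?thesis using up1 up2 by (cases "b \<le> b'") auto
  next
    case False
    then have s: "slope e < 0" using slope_nonzero[OF e(1)] by linarith
    then have "b < a" "b' < a" using m by (auto simp: zero_less_mult_iff)
    moreover have "ht q \<le> ht q' \<longleftrightarrow> b' \<le> b" "ht q' \<le> ht q \<longleftrightarrow> b \<le> b'"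
      using s hq by auto
    ultimately show ?thesis using up1 up2 by (cases "b' \<le> b") auto
  qed
qed

text \<open>The ascent from \<open>p\<close> to \<open>q\<close> either stops before the next point
  of the chain or passes through it; in the latter case the induction goes on from that
  point.\<close>

lemma up_ups:
  assumes "(up B')\<^sup>*\<^sup>* p q'" "up B p q" and "B \<inter> Vx ` Z = {}"
  shows "(q \<in> B' \<and> (up B')\<^sup>*\<^sup>* q q') \<or> (q' \<in> B \<and> (up B)\<^sup>*\<^sup>* q' q)"
  using assms(1,2)
proof (induction arbitrary: q rule: converse_rtranclp_induct)
  case base
  then show ?case using up_mem by blast
next
  case (step p p1)
  have "p \<notin> Vx ` Z" using up_mem[OF step.prems] assms(3) by blast
  from up_linear[OF step.prems step.hyps(1) this] show ?case
    using step.hyps(2) step.IH by (meson converse_rtranclp_into_rtranclp)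
qed

text \<open>Two ways up from one point follow the same route even when they run in different sets,
  so the one that ends lower is an initial part of the other and its end lies in both sets.\<close>

lemma ups_ups:
  assumes "(up B)\<^sup>*\<^sup>* p q" "p \<in> B'" "(up B')\<^sup>*\<^sup>* p q'" and "B \<inter> Vx ` Z = {}"
  shows "(q \<in> B' \<and> (up B')\<^sup>*\<^sup>* q q') \<or> (q' \<in> B \<and> (up B)\<^sup>*\<^sup>* q' q)"
  using assms(1-3)
proof (induction rule: converse_rtranclp_induct)
  case base
  then show ?case by blast
next
  case (step p p1)
  from up_ups[OF step.prems(2) step.hyps(1) assms(4)] show ?case
    using step.hyps(2) step.IH by (meson rtranclp_trans)
qed

text \<open>The walk is extended at its start. If the new step rises, the old bound still serves. If
  it descends, the old bound and the new start both lie above the lower end of the step, hence are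
  comparable, and the higher of the two serves.\<close>

lemma walk_common_upper:
  assumes "wlk p q L S" "S \<subseteq> B" and B: "B \<inter> Vx ` Z = {}"
  shows "\<exists>z\<in>B. (up B)\<^sup>*\<^sup>* p z \<and> (up B)\<^sup>*\<^sup>* q z"
  using assms(1,2)
proof induction
  case (walk_nil p)
  then show ?case by auto
next
  case (walk_step e a b r L S)
  let ?p = "par e a" and ?p' = "par e b"
  obtain z where z: "z \<in> B" "(up B)\<^sup>*\<^sup>* ?p' z" "(up B)\<^sup>*\<^sup>* r z" using walk_step by auto
  have "up B ?p ?p' \<or> up B ?p' ?p"
  proof (cases "ht ?p \<le> ht ?p'")
    case True
    then show ?thesis using up_param[OF walk_step(1-5)] walk_step.prems by simp
  next
    case False
    moreover have "par e ` {min b a..max b a} \<subseteq> B"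
      using walk_step.prems by (simp add: min.commute max.commute)
    ultimately show ?thesis
      using up_param[OF walk_step(1) walk_step(4,5) walk_step(2,3)] by simp
  qed
  then show ?case
  proof
    assume "up B ?p ?p'"
    then show ?thesis using z by (meson converse_rtranclp_into_rtranclp)
  next
    assume u: "up B ?p' ?p"
    from up_ups[OF z(2) u B] show ?thesis
      using z up_mem[OF u] by (meson rtranclp.rtrancl_refl rtranclp_trans)
  qed
qed

text \<open>Only finitely many points are bounded at a time, since an open set \<open>X\<close> may
  have no highest point.\<close>

lemma linked_upper:
  assumes "linked X" "X \<noteq> {}" "X \<inter> Vx ` Z = {}" "finite Y" "Y \<subseteq> X"
  shows "\<exists>z\<in>X. \<forall>y\<in>Y. (up X)\<^sup>*\<^sup>* y z"
  using assms(4,5)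
proof (induction rule: finite_induct)
  case empty
  then show ?case using assms(2) by auto
next
  case (insert y Y)
  then obtain z where z: "z \<in> X" "\<forall>y\<in>Y. (up X)\<^sup>*\<^sup>* y z" by auto
  obtain L S where "wlk y z L S" "S \<subseteq> X"
    using insert.prems z(1) assms(1) unfolding linked_def by (metis insert_subset)
  then obtain z' where "z' \<in> X" "(up X)\<^sup>*\<^sup>* y z'" "(up X)\<^sup>*\<^sup>* z z'"
    using walk_common_upper assms(3) by blast
  moreover from this have "\<forall>x\<in>Y. (up X)\<^sup>*\<^sup>* x z'" using z(2) by (blast intro: rtranclp_trans)
  ultimately show ?case by blast
qed

lemma simplicial_member:
  assumes "finite I" "I \<noteq> {}"
    and X: "\<And>i. i \<in> I \<Longrightarrow> linked (X i) \<and> X i \<noteq> {} \<and> X i \<inter> Vx ` Z = {}"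
  shows "\<exists>i\<in>I. \<exists>z. \<forall>i'\<in>I. X i \<inter> X i' \<noteq> {} \<longrightarrow> z \<in> X i'"
proof -
  \<comment> \<open>The witness depends only on the intersection as a set, so \<open>i\<close> and
    \<open>i'\<close> pick the same common point.\<close>
  define w where "w S = (SOME x. x \<in> S)" for S :: "'a point set"
  have w: "w S \<in> S" if "S \<noteq> {}" for S using that by (auto simp: w_def some_in_eq)
  define Y where "Y i = (\<lambda>i'. w (X i \<inter> X i')) ` {i' \<in> I. X i \<inter> X i' \<noteq> {}}" for i
  have "w (X i \<inter> X i') \<in> X i" if "X i \<inter> X i' \<noteq> {}" for i i'
    using w[OF that] by blast
  then have "Y i \<subseteq> X i" for i unfolding Y_def by blast
  moreover have "finite (Y i)" for i using assms(1) by (simp add: Y_def)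
  ultimately have "\<exists>z. z \<in> X i \<and> (\<forall>y\<in>Y i. (up (X i))\<^sup>*\<^sup>* y z)" if "i \<in> I" for i
    using linked_upper[of "X i" "Y i"] X[OF that] by blast
  then obtain z where z: "\<And>i. i \<in> I \<Longrightarrow> z i \<in> X i"
    "\<And>i y. i \<in> I \<Longrightarrow> y \<in> Y i \<Longrightarrow> (up (X i))\<^sup>*\<^sup>* y (z i)" by metis
  obtain i where i: "i \<in> I" and mini: "\<And>i'. i' \<in> I \<Longrightarrow> ht (z i) \<le> ht (z i')"
    using ex_is_arg_min_if_finite[OF assms(1,2), of "\<lambda>i. ht (z i)"]
    by (auto simp: is_arg_min_linorder)
  \<comment> \<open>The tops of two intersecting members lie above a common point, so they are comparable;
    the higher member contains the way up to its top, hence the lower top.\<close>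
  have "z i \<in> X i'" if i': "i' \<in> I" and hit: "X i \<inter> X i' \<noteq> {}" for i'
  proof -
    let ?y = "w (X i \<inter> X i')"
    have "?y \<in> Y i" using i' hit by (auto simp: Y_def)
    moreover have "?y \<in> Y i'" using i hit by (auto simp: Y_def Int_commute)
    moreover have "?y \<in> X i'" using w[OF hit] by auto
    ultimately have "z i \<in> X i' \<or> (up (X i))\<^sup>*\<^sup>* (z i') (z i)"
      using ups_ups[OF z(2)[OF i], of ?y "X i'" "z i'"] z(2)[OF i'] X[OF i] by blast
    \<comment> \<open>In the second case minimality of \<open>ht (z i)\<close> forces equal heights,
      hence \<open>z i = z i'\<close>.\<close>
    then show ?thesis
      using ups_ht[of "X i" "z i'" "z i"] mini[OF i'] z(1)[OF i'] by force
  qed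
  then show ?thesis using i by blast
qed

end

section \<open>Rainbow selection of disjoint sets\<close>

text \<open>At most \<open>card J0 - 1\<close> choices precede that of a given agent and each costs
  her at most \<open>d\<close> parts, so \<open>d * (card J0 - 1) + 1\<close> parts leave her one.
  The two bounds in the theorem come from \<open>d = 1\<close> and \<open>d = 2\<close>. The
  assumption \<open>step\<close> covers all subfamilies because the sets \<open>K j\<close> shrink
  during the selection.\<close>

lemma rainbow_greedy:
  fixes B :: "'j \<Rightarrow> 'k \<Rightarrow> 'p set"
  assumes step: "\<And>J K. J \<noteq> {} \<Longrightarrow> J \<subseteq> J0 \<Longrightarrow> (\<And>j. j \<in> J \<Longrightarrow> K j \<subseteq> K0 j \<and> K j \<noteq> {}) \<Longrightarrow>
      \<exists>j\<in>J. \<exists>k\<in>K j. \<forall>j'\<in>J - {j}. card {k' \<in> K j'. B j k \<inter> B j' k' \<noteq> {}} \<le> d"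
    and fin: "finite J0" "\<And>j. j \<in> J0 \<Longrightarrow> finite (K0 j)"
    and many: "\<And>j. j \<in> J0 \<Longrightarrow> d * (card J0 - 1) + 1 \<le> card (K0 j)"
  shows "\<exists>c. \<forall>j\<in>J0. c j \<in> K0 j \<and> (\<forall>j'\<in>J0. j \<noteq> j' \<longrightarrow> B j (c j) \<inter> B j' (c j') = {})"
proof -
  have "\<exists>c. \<forall>j\<in>J. c j \<in> K j \<and> (\<forall>j'\<in>J. j \<noteq> j' \<longrightarrow> B j (c j) \<inter> B j' (c j') = {})"
    if "J \<subseteq> J0" "\<And>j. j \<in> J \<Longrightarrow> K j \<subseteq> K0 j"
      "\<And>j. j \<in> J \<Longrightarrow> d * (card J - 1) + 1 \<le> card (K j)" for J K
    using that
  proof (induction "card J" arbitrary: J K)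
    case 0
    then have "J = {}" using fin(1) finite_subset by fastforce
    then show ?case by simp
  next
    case (Suc m)
    have "J \<noteq> {}" using Suc.hyps(2) by auto
    have finJ: "finite J" using Suc.prems(1) fin(1) finite_subset by blast
    have finK: "finite (K j)" if "j \<in> J" for j
      using Suc.prems(1,2) that fin(2) finite_subset by blast
    have "K j \<subseteq> K0 j \<and> K j \<noteq> {}" if "j \<in> J" for j
      using Suc.prems(2,3)[OF that] by auto
    then obtain j k where jk: "j \<in> J" "k \<in> K j"
      and hit: "\<And>j'. j' \<in> J - {j} \<Longrightarrow> card {k' \<in> K j'. B j k \<inter> B j' k' \<noteq> {}} \<le> d"
      using step[OF \<open>J \<noteq> {}\<close> Suc.prems(1), of K] by blast
    define J' where "J' = J - {j}"
    define K' where "K' j' = {k' \<in> K j'. B j k \<inter> B j' k' = {}}" for j'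
    have m: "m = card J'" using Suc.hyps(2) jk(1) finJ by (simp add: J'_def)
    have "d * (card J' - 1) + 1 \<le> card (K' j')" if j': "j' \<in> J'" for j'
    proof -
      let ?H = "{k' \<in> K j'. B j k \<inter> B j' k' \<noteq> {}}"
      have j'J: "j' \<in> J - {j}" using j' by (simp add: J'_def)
      have "K' j' = K j' - ?H" by (auto simp: K'_def)
      then have "card (K' j') = card (K j') - card ?H"
        using finK[of j'] j'J by (simp add: card_Diff_subset)
      moreover have "d * card J' + 1 \<le> card (K j')"
        using Suc.prems(3)[of j'] j'J Suc.hyps(2) m by (metis DiffD1 diff_Suc_1)
      moreover have "card ?H \<le> d" using hit j'J by blast
      \<comment> \<open>Keeps the truncated subtraction \<open>card J' - 1\<close> exact.\<close>
      moreover have "card J' \<noteq> 0" using j' finJ by (auto simp: J'_def)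
      then have "d * card J' = d * (card J' - 1) + d"
        by (metis Suc_pred' mult_Suc_right add.commute bot_nat_0.not_eq_extremum)
      ultimately show ?thesis by linarith
    qed
    moreover have "J' \<subseteq> J0" using Suc.prems(1) by (auto simp: J'_def)
    moreover have "K' j' \<subseteq> K0 j'" if "j' \<in> J'" for j'
      using Suc.prems(2)[of j'] that by (auto simp: J'_def K'_def)
    ultimately obtain c where c: "\<And>j'. j' \<in> J' \<Longrightarrow> c j' \<in> K' j'"
      "\<And>j1 j2. j1 \<in> J' \<Longrightarrow> j2 \<in> J' \<Longrightarrow> j1 \<noteq> j2 \<Longrightarrow> B j1 (c j1) \<inter> B j2 (c j2) = {}"
      using Suc.hyps(1)[OF m, of K'] by metis
    have c': "c j' \<in> K j'" "B j k \<inter> B j' (c j') = {}" if "j' \<in> J" "j' \<noteq> j" for j'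
      using c(1)[of j'] that by (auto simp: J'_def K'_def)
    show ?case
    proof (intro exI[of _ "c(j := k)"] ballI conjI impI)
      fix j1 assume "j1 \<in> J"
      then show "(c(j := k)) j1 \<in> K j1" using c' jk by auto
      fix j2 assume "j2 \<in> J" "j1 \<noteq> j2"
      then show "B j1 ((c(j := k)) j1) \<inter> B j2 ((c(j := k)) j2) = {}"
        using c' c(2)[of j1 j2] \<open>j1 \<in> J\<close>
        by (cases "j1 = j"; cases "j2 = j") (auto simp: J'_def Int_commute)
    qed
  qed
  from this[of J0 K0] many show ?thesis by blast
qed

lemma card_common_point:
  assumes "\<And>k k'. k \<in> K \<Longrightarrow> k' \<in> K \<Longrightarrow> k \<noteq> k' \<Longrightarrow> X k \<inter> X k' = {}"
  shows "card {k \<in> K. z \<in> X k} \<le> 1"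
proof (cases "finite {k \<in> K. z \<in> X k}")
  case True
  show ?thesis
    unfolding One_nat_def card_le_Suc0_iff_eq[OF True] using assms by blast
qed simp

context cake
begin

lemma simplicial_member_forest:
  assumes "\<not> has_cycle (V - Z) E" "finite I" "I \<noteq> {}"
    and "\<And>i. i \<in> I \<Longrightarrow> linked (X i) \<and> X i \<noteq> {} \<and> X i \<inter> Vx ` Z = {}"
  shows "\<exists>i\<in>I. \<exists>z. \<forall>i'\<in>I. X i \<inter> X i' \<noteq> {} \<longrightarrow> z \<in> X i'"
proof -
  obtain \<rho> :: "'v \<Rightarrow> real" where \<rho>: "inj_on \<rho> V"
    "\<And>u x y. u \<in> V - Z \<Longrightarrow> x \<in> V \<Longrightarrow> y \<in> V \<Longrightarrow> adj E u x \<Longrightarrow> adj E u y \<Longrightarrow>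
       \<rho> u < \<rho> x \<Longrightarrow> \<rho> u < \<rho> y \<Longrightarrow> x = y"
    using rank_exists[OF assms(1)] by metis
  interpret ranked_cake V E len Z \<rho> by unfold_locales (fact \<rho>)+
  show ?thesis using simplicial_member[OF assms(2-4)] .
qed

lemma simplicial_pair:
  assumes "\<not> has_cycle (V - Z) E" "finite J" "\<And>j. j \<in> J \<Longrightarrow> finite (K j)"
    and ne: "j0 \<in> J" "k0 \<in> K j0"
    and lk: "\<And>j k. j \<in> J \<Longrightarrow> k \<in> K j \<Longrightarrow> linked (B j k) \<and> B j k \<noteq> {} \<and> B j k \<inter> Vx ` Z = {}"
  shows "\<exists>j\<in>J. \<exists>k\<in>K j. \<exists>z. \<forall>j'\<in>J. \<forall>k'\<in>K j'. B j k \<inter> B j' k' \<noteq> {} \<longrightarrow> z \<in> B j' k'"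
proof -
  define X where "X i = B (fst i) (snd i)" for i
  have "\<exists>i\<in>Sigma J K. \<exists>z. \<forall>i'\<in>Sigma J K. X i \<inter> X i' \<noteq> {} \<longrightarrow> z \<in> X i'"
  proof (rule simplicial_member_forest[OF assms(1)])
    show "finite (Sigma J K)" using assms(2,3) by (rule finite_SigmaI)
    show "Sigma J K \<noteq> {}" using ne by auto
    show "linked (X i) \<and> X i \<noteq> {} \<and> X i \<inter> Vx ` Z = {}" if "i \<in> Sigma J K" for i
      using lk[of "fst i" "snd i"] that unfolding X_def by (metis SigmaE fst_conv snd_conv)
  qed
  then obtain i z where i: "i \<in> Sigma J K"
    and z: "\<forall>i'\<in>Sigma J K. X i \<inter> X i' \<noteq> {} \<longrightarrow> z \<in> X i'"
    by (elim bexE exE)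
  have "z \<in> B j' k'" if "j' \<in> J" "k' \<in> K j'" "B (fst i) (snd i) \<inter> B j' k' \<noteq> {}" for j' k'
    using bspec[OF z, of "(j', k')"] that by (simp add: X_def)
  moreover have "fst i \<in> J" "snd i \<in> K (fst i)" using i by auto
  ultimately show ?thesis
    by (intro bexI[of _ "fst i"] bexI[of _ "snd i"] exI[of _ z]) blast+
qed

text \<open>Discarding at most \<open>card Z\<close> parts leaves each agent at least
  \<open>n = 1 * (n - 1) + 1\<close> parts, which is what the greedy selection with
  \<open>d = 1\<close> requires.\<close>

lemma rainbow_feedback_number:
  assumes Z: "Z \<subseteq> V" "\<not> has_cycle (V - Z) E"
    and lk: "\<And>i k. i < n \<Longrightarrow> k < N \<Longrightarrow> linked (B i k)"
    and disj: "\<And>i k k'. i < n \<Longrightarrow> k < N \<Longrightarrow> k' < N \<Longrightarrow> k \<noteq> k' \<Longrightarrow> B i k \<inter> B i k' = {}"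
    and N: "n + card Z \<le> N" and n: "1 \<le> n"
  shows "\<exists>c. \<forall>i<n. c i < N \<and> (\<forall>i'<n. i \<noteq> i' \<longrightarrow> B i (c i) \<inter> B i' (c i') = {})"
proof -
  have finZ: "finite Z" using Z(1) finite_V finite_subset by blast
  define K0 where "K0 i = {k. k < N \<and> B i k \<inter> Vx ` Z = {}}" for i
  have "\<exists>c. \<forall>j\<in>{..<n}. c j \<in> K0 j \<and>
      (\<forall>j'\<in>{..<n}. j \<noteq> j' \<longrightarrow> B j (c j) \<inter> B j' (c j') = {})"
  proof (rule rainbow_greedy[where d = 1])
    fix J K assume J: "J \<noteq> {}" "J \<subseteq> {..<n}" and K: "\<And>j. j \<in> J \<Longrightarrow> K j \<subseteq> K0 j \<and> K j \<noteq> {}"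
    show "\<exists>j\<in>J. \<exists>k\<in>K j. \<forall>j'\<in>J - {j}. card {k' \<in> K j'. B j k \<inter> B j' k' \<noteq> {}} \<le> 1"
    \<comment> \<open>Parts may be empty. An empty neighbourhood meets nothing and can be given out
      at no cost, so the forest argument only has to treat nonempty sets.\<close>
    proof (cases "\<exists>j\<in>J. \<exists>k\<in>K j. B j k = {}")
      case True
      then obtain j k where "j \<in> J" "k \<in> K j" "B j k = {}" by blast
      then show ?thesis by (intro bexI[of _ j] bexI[of _ k]) auto
    next
      case False
      obtain j0 k0 where "j0 \<in> J" "k0 \<in> K j0" using J K by fast
      moreover have "finite (K j)" if "j \<in> J" for j
        by (rule finite_subset[of _ "{..<N}"]) (use K[OF that] in \<open>auto simp: K0_def\<close>)
      moreover have "linked (B j k) \<and> B j k \<noteq> {} \<and> B j k \<inter> Vx ` Z = {}"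
        if jk: "j \<in> J" "k \<in> K j" for j k
      proof -
        have "k \<in> K0 j" "j < n" using jk J(2) K by auto
        then show ?thesis using jk lk[of j k] False by (auto simp: K0_def)
      qed
      moreover have "finite J" using J(2) finite_subset by blast
      ultimately have "\<exists>j\<in>J. \<exists>k\<in>K j. \<exists>z. \<forall>j'\<in>J. \<forall>k'\<in>K j'. B j k \<inter> B j' k' \<noteq> {} \<longrightarrow> z \<in> B j' k'"
        by (intro simplicial_pair[OF Z(2)])
      then obtain j k z where jk: "j \<in> J" "k \<in> K j"
        and z: "\<forall>j'\<in>J. \<forall>k'\<in>K j'. B j k \<inter> B j' k' \<noteq> {} \<longrightarrow> z \<in> B j' k'"
        by (elim bexE exE)
      have "card {k' \<in> K j'. B j k \<inter> B j' k' \<noteq> {}} \<le> 1" if j': "j' \<in> J - {j}" for j'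
      proof -
        have "finite (K j')"
          by (rule finite_subset[of _ "{..<N}"]) (use K[of j'] j' in \<open>auto simp: K0_def\<close>)
        then have "card {k' \<in> K j'. B j k \<inter> B j' k' \<noteq> {}} \<le> card {k' \<in> K j'. z \<in> B j' k'}"
          using z j' by (intro card_mono) auto
        also have "\<dots> \<le> 1"
        proof (rule card_common_point)
          fix k1 k2 assume "k1 \<in> K j'" "k2 \<in> K j'" "k1 \<noteq> k2"
          moreover have "j' < n" "K j' \<subseteq> K0 j'" using j' J(2) K by auto
          ultimately show "B j' k1 \<inter> B j' k2 = {}"
            using disj[of j' k1 k2] by (auto simp: K0_def)
        qed
        finally show ?thesis .
      qed
      then show ?thesis using jk by blast
    qed
  next
    fix j assume "j \<in> {..<n}"
    then have j: "j < n" by simp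
    define D where "D = {k. k < N \<and> B j k \<inter> Vx ` Z \<noteq> {}}"
    \<comment> \<open>Choosing a vertex of \<open>Z\<close> in each discarded set is injective
      because the sets of one agent are disjoint.\<close>
    have "card D \<le> card Z"
    proof -
      have "\<forall>k\<in>D. \<exists>z. z \<in> Z \<and> Vx z \<in> B j k" by (auto simp: D_def)
      then obtain g where g: "\<And>k. k \<in> D \<Longrightarrow> g k \<in> Z \<and> Vx (g k) \<in> B j k" by metis
      have "inj_on g D"
      proof (rule inj_onI, rule ccontr)
        fix k k' assume "k \<in> D" "k' \<in> D" "g k = g k'" "k \<noteq> k'"
        moreover from this have "B j k \<inter> B j k' = {}" using disj[OF j] by (auto simp: D_def)
        ultimately show False using g[of k] g[of k'] by auto
      qed
      then show ?thesis using g finZ by (intro card_inj_on_le[of g]) auto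
    qed
    moreover have "K0 j = {..<N} - D" by (auto simp: K0_def D_def)
    moreover have "D \<subseteq> {..<N}" by (auto simp: D_def)
    ultimately have "card (K0 j) = N - card D" "card D \<le> card Z"
      by (simp_all add: card_Diff_subset finite_subset)
    then show "1 * (card {..<n} - 1) + 1 \<le> card (K0 j)" using N n by simp
    show "finite (K0 j)" by (auto simp: K0_def)
  qed auto
  then obtain c where "\<forall>j\<in>{..<n}. c j \<in> K0 j \<and>
      (\<forall>j'\<in>{..<n}. j \<noteq> j' \<longrightarrow> B j (c j) \<inter> B j' (c j') = {})" ..
  then show ?thesis by (intro exI[of _ c]) (simp add: K0_def)
qed

text \<open>Nothing is discarded in advance here, since with many components \<open>Z\<close> may be
  larger than the number of parts. The price is \<open>d = 2\<close>, and
  \<open>2 * (n - 1) + 1 = 2 * n - 1\<close>. The assumption \<open>uniq\<close> expresses through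
  walks that each component contains at most one vertex of \<open>Z\<close>.\<close>

lemma rainbow_components:
  fixes n N :: nat
  assumes Z: "\<not> has_cycle (V - Z) E"
    and uniq: "\<And>z z' L S. z \<in> Z \<Longrightarrow> z' \<in> Z \<Longrightarrow> wlk (Vx z) (Vx z') L S \<Longrightarrow> z = z'"
    and lk: "\<And>i k. i < n \<Longrightarrow> k < N \<Longrightarrow> linked (B i k)"
    and disj: "\<And>i k k'. i < n \<Longrightarrow> k < N \<Longrightarrow> k' < N \<Longrightarrow> k \<noteq> k' \<Longrightarrow> B i k \<inter> B i k' = {}"
    and N: "2 * n - 1 \<le> N" and n: "1 \<le> n"
  shows "\<exists>c. \<forall>i<n. c i < N \<and> (\<forall>i'<n. i \<noteq> i' \<longrightarrow> B i (c i) \<inter> B i' (c i') = {})"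
proof -
  have "\<exists>c. \<forall>j\<in>{..<n}. c j \<in> {..<N} \<and>
      (\<forall>j'\<in>{..<n}. j \<noteq> j' \<longrightarrow> B j (c j) \<inter> B j' (c j') = {})"
  proof (rule rainbow_greedy[where d = 2])
    fix J :: "nat set" and K :: "nat \<Rightarrow> nat set"
    assume J: "J \<noteq> {}" "J \<subseteq> {..<n}" and K: "\<And>j. j \<in> J \<Longrightarrow> K j \<subseteq> {..<N} \<and> K j \<noteq> {}"
    have finK: "finite (K j)" if "j \<in> J" for j using K[OF that] finite_subset[of "K j" "{..<N}"] by simp
    have inK: "j < n" "k < N" if "j \<in> J" "k \<in> K j" for j k
      using J(2) K[OF that(1)] that by auto
    have disjK: "B j k1 \<inter> B j k2 = {}" if "j \<in> J" "k1 \<in> K j" "k2 \<in> K j" "k1 \<noteq> k2" for j k1 k2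
      using disj[OF inK(1)[OF that(1,2)] inK(2)[OF that(1,2)] inK(2)[OF that(1,3)] that(4)] .
    have lkK: "linked (B j k)" if "j \<in> J" "k \<in> K j" for j k
      using lk[OF inK[OF that]] .
    \<comment> \<open>Two such parts are joined through \<open>B j k\<close>, so their vertices of
      \<open>Z\<close> are joined by a walk and coincide; disjoint parts cannot share that
      vertex.\<close>
    have few: "card {k' \<in> K j'. B j k \<inter> B j' k' \<noteq> {} \<and> B j' k' \<inter> Vx ` Z \<noteq> {}} \<le> 1"
      (is "card ?H \<le> 1") if jk: "j \<in> J" "k \<in> K j" and j': "j' \<in> J" for j k j'
    proof -
      have "k1 = k2" if k1: "k1 \<in> ?H" and k2: "k2 \<in> ?H" for k1 k2
      proof (rule ccontr)
        assume "k1 \<noteq> k2"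
        obtain x1 z1 x2 z2 where *: "x1 \<in> B j k" "x1 \<in> B j' k1" "z1 \<in> Z" "Vx z1 \<in> B j' k1"
          "x2 \<in> B j k" "x2 \<in> B j' k2" "z2 \<in> Z" "Vx z2 \<in> B j' k2"
          using k1 k2 by blast
        have lk': "linked (B j' k1)" "linked (B j' k2)" using lkK[OF j'] k1 k2 by simp_all
        obtain L1 S1 where "wlk (Vx z1) x1 L1 S1" using lk'(1) *(2,4) unfolding linked_def by blast
        moreover obtain L S where "wlk x1 x2 L S"
          using lkK[OF jk] *(1,5) unfolding linked_def by blast
        moreover obtain L2 S2 where "wlk x2 (Vx z2) L2 S2"
          using lk'(2) *(6,8) unfolding linked_def by blast
        ultimately have "z1 = z2" using walk_append uniq[OF *(3,7)] by meson
        then show False using disjK[OF j' _ _ \<open>k1 \<noteq> k2\<close>] k1 k2 * by blast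
      qed
      moreover have "finite ?H" using finK[OF j'] by simp
      ultimately show ?thesis unfolding One_nat_def by (subst card_le_Suc0_iff_eq) blast+
    qed
    show "\<exists>j\<in>J. \<exists>k\<in>K j. \<forall>j'\<in>J - {j}. card {k' \<in> K j'. B j k \<inter> B j' k' \<noteq> {}} \<le> 2"
    proof (cases "\<exists>j\<in>J. \<exists>k\<in>K j. B j k = {}")
      case True
      then obtain j k where "j \<in> J" "k \<in> K j" "B j k = {}" by blast
      then show ?thesis by (intro bexI[of _ j] bexI[of _ k]) auto
    next
      case nonempty: False
      define K1 where "K1 j = {k \<in> K j. B j k \<inter> Vx ` Z = {}}" for j
      show ?thesis
      proof (cases "\<exists>j\<in>J. K1 j \<noteq> {}")
        case True
        then obtain j0 k0 where "j0 \<in> J" "k0 \<in> K1 j0" by blast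
        moreover have "finite (K1 j)" if "j \<in> J" for j using finK[OF that] by (simp add: K1_def)
        moreover have "linked (B j k) \<and> B j k \<noteq> {} \<and> B j k \<inter> Vx ` Z = {}"
          if "j \<in> J" "k \<in> K1 j" for j k
          using that lkK[of j k] nonempty by (auto simp: K1_def)
        moreover have "finite J" using J(2) finite_subset by blast
        ultimately have "\<exists>j\<in>J. \<exists>k\<in>K1 j. \<exists>z. \<forall>j'\<in>J. \<forall>k'\<in>K1 j'. B j k \<inter> B j' k' \<noteq> {} \<longrightarrow> z \<in> B j' k'"
          by (intro simplicial_pair[OF Z])
        then obtain j k z where jk: "j \<in> J" "k \<in> K1 j"
          and z: "\<forall>j'\<in>J. \<forall>k'\<in>K1 j'. B j k \<inter> B j' k' \<noteq> {} \<longrightarrow> z \<in> B j' k'"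
          by (elim bexE exE)
        have kK: "k \<in> K j" using jk(2) by (simp add: K1_def)
        have "card {k' \<in> K j'. B j k \<inter> B j' k' \<noteq> {}} \<le> 2" if j': "j' \<in> J - {j}" for j'
        proof -
          let ?H = "{k' \<in> K j'. B j k \<inter> B j' k' \<noteq> {} \<and> B j' k' \<inter> Vx ` Z \<noteq> {}}"
          \<comment> \<open>A set that meets \<open>B j k\<close> either contains a vertex of
            \<open>Z\<close> or belongs to \<open>K1 j'\<close> and so contains \<open>z\<close>;
            each kind occurs at most once per agent.\<close>
          have "{k' \<in> K j'. B j k \<inter> B j' k' \<noteq> {}} \<subseteq> ?H \<union> {k' \<in> K j'. z \<in> B j' k'}"
            using z j' by (auto simp: K1_def)
          then have "card {k' \<in> K j'. B j k \<inter> B j' k' \<noteq> {}} \<le> card (?H \<union> {k' \<in> K j'. z \<in> B j' k'})"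
            using finK[of j'] j' by (intro card_mono) auto
          also have "\<dots> \<le> card ?H + card {k' \<in> K j'. z \<in> B j' k'}" by (rule card_Un_le)
          also have "\<dots> \<le> 1 + 1"
            using few[OF jk(1) kK, of j'] j' disjK[of j']
            by (intro add_mono card_common_point) auto
          finally show ?thesis by simp
        qed
        then show ?thesis using jk(1) kK by blast
      next
        case False
        obtain j k where jk: "j \<in> J" "k \<in> K j" using J K by fast
        have "card {k' \<in> K j'. B j k \<inter> B j' k' \<noteq> {}} \<le> 2" if j': "j' \<in> J - {j}" for j'
        proof -
          have "{k' \<in> K j'. B j k \<inter> B j' k' \<noteq> {}}
              = {k' \<in> K j'. B j k \<inter> B j' k' \<noteq> {} \<and> B j' k' \<inter> Vx ` Z \<noteq> {}}"
            using False j' by (auto simp: K1_def)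
          then show ?thesis using few[OF jk, of j'] j' by simp
        qed
        then show ?thesis using jk by blast
      qed
    qed
  qed (use N n in auto)
  then show ?thesis by (simp add: Ball_def)
qed

section \<open>Walks, graph components and feedback sets\<close>

definition base_vertex :: "'v point \<Rightarrow> 'v" where
  "base_vertex p = (case p of Vx u \<Rightarrow> u | Ep e t \<Rightarrow> fst e)"

abbreviation "nbr \<equiv> \<lambda>a b. a \<in> V \<and> b \<in> V \<and> adj E a b"

lemma nbr_sym: "nbr\<^sup>*\<^sup>* a b \<Longrightarrow> nbr\<^sup>*\<^sup>* b a"
  by (rule symp_rtranclp[THEN sympD]) (auto simp: symp_def adj_def)

text \<open>Translates between connection by walks and the graph components in which the hypothesis
  on \<open>FvsNum\<close> is phrased: a step of a walk stays on one edge, and the base vertices of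
  its ends are ends of that edge.\<close>

lemma walk_component: "wlk p q L S \<Longrightarrow> nbr\<^sup>*\<^sup>* (base_vertex p) (base_vertex q)"
proof (induction rule: walk.induct)
  case (walk_nil p)
  then show ?case by simp
next
  case (walk_step e a b r L S)
  have "nbr (fst e) (snd e)" "nbr (snd e) (fst e)"
    using fst_in_V snd_in_V walk_step(1) by (auto simp: adj_def)
  moreover have "base_vertex (par e c) \<in> {fst e, snd e}" for c
    by (auto simp: base_vertex_def param_def)
  ultimately have "nbr\<^sup>*\<^sup>* (base_vertex (par e a)) (base_vertex (par e b))"
    by (metis (mono_tags, lifting) insertE r_into_rtranclp rtranclp.rtrancl_refl singletonD)
  then show ?case using walk_step.IH by (rule rtranclp_trans)
qed

lemma component_eq:
  assumes "z \<in> component V E x" shows "component V E z = component V E x"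
  using assms nbr_sym rtranclp_trans[of nbr] unfolding component_def by blast

text \<open>\<open>Z\<close> is the union of minimum feedback sets of the components. It meets every
  cycle because a cycle stays in one component.\<close>

lemma component_feedback_set:
  assumes "\<forall>x\<in>V. FvsNum (component V E x) E \<le> 1"
  obtains Z where "Z \<subseteq> V" "\<not> has_cycle (V - Z) E"
    "\<And>z z' L S. z \<in> Z \<Longrightarrow> z' \<in> Z \<Longrightarrow> wlk (Vx z) (Vx z') L S \<Longrightarrow> z = z'"
proof -
  define C where "C = component V E"
  have "\<exists>S\<subseteq>W. card S = FvsNum W E \<and> \<not> has_cycle (W - S) E" for W
    unfolding FvsNum_def
    \<comment> \<open>Removing all of \<open>W\<close> leaves no cycle, so the least size is
      attained.\<close>
    by (rule LeastI[of _ "card W"]) (auto simp: has_cycle_def intro!: exI[of _ W])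
  \<comment> \<open>\<open>F\<close> is a function of the component as a set, so all vertices of one
    component contribute the same feedback set to \<open>Z\<close>.\<close>
  then obtain F where F: "\<And>W. F W \<subseteq> W" "\<And>W. card (F W) = FvsNum W E"
    "\<And>W. \<not> has_cycle (W - F W) E" by metis
  have CV: "C x \<subseteq> V" for x by (auto simp: C_def component_def)
  define Z where "Z = (\<Union>x\<in>V. F (C x))"
  show ?thesis
  proof
    show "Z \<subseteq> V" using F(1) CV by (force simp: Z_def)
    show "\<not> has_cycle (V - Z) E"
    proof
      assume "has_cycle (V - Z) E"
      then obtain cs where cs: "3 \<le> length cs" "distinct cs" "set cs \<subseteq> V - Z"
        "\<forall>i < length cs - 1. adj E (cs ! i) (cs ! Suc i)" "adj E (last cs) (hd cs)"
        unfolding has_cycle_def by blast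
      define x where "x = cs ! 0"
      have V: "cs ! i \<in> V" if "i < length cs" for i using cs(3) that nth_mem by blast
      have x: "x \<in> V" unfolding x_def using cs(1) by (intro V) linarith
      have "nbr\<^sup>*\<^sup>* x (cs ! i)" if "i < length cs" for i
        using that
      proof (induction i)
        case 0
        then show ?case by (simp add: x_def)
      next
        case (Suc i)
        then have "nbr (cs ! i) (cs ! Suc i)" using cs(4) V by simp
        then show ?case
          using Suc rtranclp.rtrancl_into_rtrancl[of nbr x "cs ! i" "cs ! Suc i"] by simp
      qed
      then have "set cs \<subseteq> C x"
        using V unfolding C_def component_def by (auto simp: in_set_conv_nth)
      moreover have "F (C x) \<subseteq> Z" using x by (auto simp: Z_def)
      ultimately have "set cs \<subseteq> C x - F (C x)" using cs(3) by blast
      then have "has_cycle (C x - F (C x)) E" using cs unfolding has_cycle_def by blast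
      then show False using F(3) by blast
    qed
    fix z z' L S assume z: "z \<in> Z" "z' \<in> Z" and w: "wlk (Vx z) (Vx z') L S"
    obtain x x' where x: "x \<in> V" "z \<in> F (C x)" "x' \<in> V" "z' \<in> F (C x')"
      using z by (auto simp: Z_def)
    have zC: "z \<in> C x" "z' \<in> C x'" using x F(1) by blast+
    have "z' \<in> C z" using walk_component[OF w] zC CV
      by (auto simp: base_vertex_def C_def component_def)
    then have "C z' = C z" "C z = C x" "C z' = C x'"
      using zC component_eq unfolding C_def by blast+
    then have "z' \<in> F (C x)" using x by simp
    moreover have "card (F (C x)) \<le> 1" using assms x(1) F(2) by (simp add: C_def)
    moreover have "finite (F (C x))" using F(1) CV finite_V by (meson finite_subset)
    ultimately show "z = z'" using x(2) by (metis One_nat_def card_le_Suc0_iff_eq)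
  qed
qed

lemma feedback_set:
  obtains Z where "Z \<subseteq> V" "card Z = FvsNum V E" "\<not> has_cycle (V - Z) E"
proof -
  have "\<exists>S\<subseteq>V. card S = FvsNum V E \<and> \<not> has_cycle (V - S) E"
    unfolding FvsNum_def
    by (rule LeastI[of _ "card V"]) (auto simp: has_cycle_def intro!: exI[of _ V])
  then show ?thesis using that by blast
qed

end

section \<open>Limits of connected pieces\<close>

text \<open>Bolzano-Weierstrass, one index at a time: each new index refines the subsequence found
  so far.\<close>

lemma common_convergent_subsequence:
  fixes f :: "nat \<Rightarrow> 'i \<Rightarrow> real"
  assumes "finite I" "\<And>m i. i \<in> I \<Longrightarrow> \<bar>f m i\<bar> \<le> M i"
  shows "\<exists>r l. strict_mono (r :: nat \<Rightarrow> nat) \<and> (\<forall>i\<in>I. (\<lambda>m. f (r m) i) \<longlonglongrightarrow> l i)"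
  using assms
proof (induction rule: finite_induct)
  case empty
  then show ?case by (auto intro: strict_mono_id)
next
  case (insert i I)
  then obtain r l where r: "strict_mono (r :: nat \<Rightarrow> nat)" "\<forall>i\<in>I. (\<lambda>m. f (r m) i) \<longlonglongrightarrow> l i"
    by auto
  have "bounded (range (\<lambda>m. f (r m) i))"
    using insert.prems[of i] by (auto simp: bounded_iff)
  then obtain x r' where r': "strict_mono (r' :: nat \<Rightarrow> nat)" "((\<lambda>m. f (r m) i) \<circ> r') \<longlonglongrightarrow> x"
    using bounded_imp_convergent_subsequence by blast
  have "(\<lambda>m. f ((r \<circ> r') m) j) \<longlonglongrightarrow> (l(i := x)) j" if "j \<in> insert i I" for j
  proof (cases "j = i")
    case True
    then show ?thesis using r'(2) by (simp add: o_def)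
  next
    case False
    then have "(\<lambda>m. f (r m) j) \<longlonglongrightarrow> l j" using that r(2) by blast
    from LIMSEQ_subseq_LIMSEQ[OF this r'(1)] show ?thesis using False by (simp add: o_def)
  qed
  then show ?case using strict_mono_o[OF r(1) r'(1)] by blast
qed

lemma finite_union_intervals_Un:
  assumes "is_interval S" "is_interval T"
  shows "finite_union_intervals (S \<union> T)"
  unfolding finite_union_intervals_def by (rule exI[of _ "{S, T}"]) (use assms in auto)

section \<open>Closed connected pieces with finitely many parameters\<close>

context cake
begin

text \<open>Codes for closed connected pieces. \<open>Inl e\<close> is a closed interval in the edge \<open>e\<close>. \<open>Inr (W, F)\<close> is
  a piece with vertex set \<open>W\<close>, together with an initial segment up to \<open>a e\<close> of each edge starting in
  \<open>W\<close> and a final segment from \<open>b e\<close> on of each edge ending in \<open>W\<close>; the edges in \<open>F\<close>, which are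
  filled completely, witness connectedness. There are finitely many such types, and for a fixed type
  validity is a closed condition on the parameters. In a limit a segment may swallow a vertex that
  is not listed in \<open>W\<close>; this is harmless.\<close>

definition coded :: "('v \<times> 'v) + 'v set \<times> ('v \<times> 'v) set \<Rightarrow> ('v \<times> 'v \<Rightarrow> real) \<Rightarrow>
    ('v \<times> 'v \<Rightarrow> real) \<Rightarrow> 'v point set" where
  "coded \<tau> a b = (case \<tau> of
      Inl e \<Rightarrow> par e ` {a e..b e}
    | Inr (W, F) \<Rightarrow> Vx ` W \<union> (\<Union>e\<in>{e \<in> E. fst e \<in> W}. par e ` {0..a e})
        \<union> (\<Union>e\<in>{e \<in> E. snd e \<in> W}. par e ` {b e..len e}))"

definition valid :: "('v \<times> 'v) + 'v set \<times> ('v \<times> 'v) set \<Rightarrow> ('v \<times> 'v \<Rightarrow> real) \<Rightarrow>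
    ('v \<times> 'v \<Rightarrow> real) \<Rightarrow> bool" where
  "valid \<tau> a b \<longleftrightarrow> (\<forall>e\<in>E. 0 \<le> a e \<and> a e \<le> len e \<and> 0 \<le> b e \<and> b e \<le> len e) \<and> (case \<tau> of
      Inl e \<Rightarrow> e \<in> E \<and> a e \<le> b e
    | Inr (W, F) \<Rightarrow> W \<subseteq> V \<and> F \<subseteq> E \<and> (\<forall>e\<in>F. fst e \<in> W \<and> snd e \<in> W \<and> a e = len e)
        \<and> (\<forall>u\<in>W. \<forall>w\<in>W. (adj F)\<^sup>*\<^sup>* u w))"

lemma valid_bounds:
  "valid \<tau> a b \<Longrightarrow> e \<in> E \<Longrightarrow> 0 \<le> a e \<and> a e \<le> len e \<and> 0 \<le> b e \<and> b e \<le> len e"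
  by (simp add: valid_def)

lemma coded_cases:
  assumes "valid \<tau> a b" "p \<in> coded \<tau> a b"
  obtains (interval) e t where "\<tau> = Inl e" "e \<in> E" "p = par e t" "a e \<le> t" "t \<le> b e"
  | (vertex) W F u where "\<tau> = Inr (W, F)" "u \<in> W" "u \<in> V" "p = Vx u"
  | (low) W F e t where "\<tau> = Inr (W, F)" "e \<in> E" "fst e \<in> W" "p = par e t" "0 \<le> t" "t \<le> a e"
  | (high) W F e t where "\<tau> = Inr (W, F)" "e \<in> E" "snd e \<in> W" "p = par e t" "b e \<le> t" "t \<le> len e"
proof (cases \<tau>)
  case (Inl e)
  then show ?thesis using assms interval[of e] by (auto simp: valid_def coded_def)
next
  case (Inr y)
  obtain W F where "y = (W, F)" by (cases y)
  then have \<tau>: "\<tau> = Inr (W, F)" using Inr by simp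
  have "p \<in> Vx ` W \<union> (\<Union>e\<in>{e \<in> E. fst e \<in> W}. par e ` {0..a e})
        \<union> (\<Union>e\<in>{e \<in> E. snd e \<in> W}. par e ` {b e..len e})"
    using assms(2) by (simp add: coded_def \<tau>)
  moreover have "W \<subseteq> V" using assms(1) by (simp add: valid_def \<tau>)
  ultimately show ?thesis using vertex[OF \<tau>] low[OF \<tau>] high[OF \<tau>] by auto
qed

lemma coded_vertex: "u \<in> W \<Longrightarrow> Vx u \<in> coded (Inr (W, F)) a b"
  by (simp add: coded_def)

lemma coded_low:
  "e \<in> E \<Longrightarrow> fst e \<in> W \<Longrightarrow> 0 \<le> t \<Longrightarrow> t \<le> a e \<Longrightarrow> par e t \<in> coded (Inr (W, F)) a b"
  unfolding coded_def sum.case prod.case by (rule UnI1, rule UnI2, rule UN_I[of e]) auto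

lemma coded_high:
  "e \<in> E \<Longrightarrow> snd e \<in> W \<Longrightarrow> b e \<le> t \<Longrightarrow> t \<le> len e \<Longrightarrow> par e t \<in> coded (Inr (W, F)) a b"
  unfolding coded_def sum.case prod.case by (rule UnI2, rule UN_I[of e]) auto

lemma coded_interval: "a e \<le> t \<Longrightarrow> t \<le> b e \<Longrightarrow> par e t \<in> coded (Inl e) a b"
  by (auto simp: coded_def)

lemma on_edge_coded_interval:
  "on_edge len e (coded (Inl e') a b) = (if e = e' then {0<..<len e} \<inter> {a e..b e} else {})"
proof -
  have "Ep e t \<in> coded (Inl e') a b \<longleftrightarrow> e = e' \<and> a e \<le> t \<and> t \<le> b e"
    if "0 < t" "t < len e" for t
    using that by (auto simp: coded_def image_iff param_eq_Ep eq_commute[of "Ep e t"])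
  then show ?thesis by (auto simp: on_edge_def)
qed

lemma on_edge_coded_tree:
  assumes "e \<in> E"
  shows "on_edge len e (coded (Inr (W, F)) a b) =
    (if fst e \<in> W then {0<..<len e} \<inter> {..a e} else {}) \<union>
    (if snd e \<in> W then {0<..<len e} \<inter> {b e..} else {})"
proof -
  have "Ep e t \<in> coded (Inr (W, F)) a b \<longleftrightarrow> (fst e \<in> W \<and> t \<le> a e) \<or> (snd e \<in> W \<and> b e \<le> t)"
    if "0 < t" "t < len e" for t
    using that assms by (auto simp: coded_def image_iff param_eq_Ep eq_commute[of "Ep e t"])
  then show ?thesis by (auto simp: on_edge_def)
qed

lemma is_interval_Int_greaterThanLessThan: "is_interval ({0<..<c::real} \<inter> {x..y})"
  "is_interval ({0<..<c::real} \<inter> {..y})" "is_interval ({0<..<c::real} \<inter> {x..})"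
  by (auto simp: is_interval_1)

lemma coded_piece:
  assumes "valid \<tau> a b" shows "piece V E len (coded \<tau> a b)"
  unfolding piece_def
proof (intro conjI ballI subsetI)
  fix p assume "p \<in> coded \<tau> a b"
  from assms this show "p \<in> pts V E len"
  proof (cases rule: coded_cases)
    case (vertex W F u)
    then show ?thesis by (simp add: pts_def)
  qed (simp_all add: param_in_pts)
next
  fix e assume e: "e \<in> E"
  show "finite_union_intervals (on_edge len e (coded \<tau> a b))"
  proof (cases \<tau>)
    case (Inl e')
    have "finite_union_intervals (S \<union> {})" if "is_interval S" for S
      using that by (intro finite_union_intervals_Un) auto
    then show ?thesis
      unfolding Inl on_edge_coded_interval using is_interval_Int_greaterThanLessThan(1) by auto
  next
    case (Inr y)
    then obtain W F where "\<tau> = Inr (W, F)" by (cases y) auto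
    then show ?thesis
      by (simp only: on_edge_coded_tree[OF e])
        (intro finite_union_intervals_Un, simp_all add: is_interval_Int_greaterThanLessThan)
  qed
qed

text \<open>Every point runs along its own segment to a vertex of \<open>W\<close>, and the vertices
  of \<open>W\<close> are joined by the completely filled edges in \<open>F\<close>.\<close>

lemma coded_tree_linked:
  assumes "valid (Inr (W, F)) a b"
  shows "linked (coded (Inr (W, F)) a b)" (is "linked ?C")
proof -
  have to_vertex: "\<exists>u\<in>W. \<exists>L S. wlk p (Vx u) L S \<and> S \<subseteq> ?C" if "p \<in> ?C" for p
    using assms that
  proof (cases rule: coded_cases)
    case (vertex W' F' u)
    have "wlk (Vx u) (Vx u) 0 {Vx u}"
      by (rule walk_nil) (use vertex in \<open>simp add: pts_def\<close>)
    then show ?thesis using vertex that by auto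
  next
    case (low W' F' e t)
    then have "wlk p (Vx (fst e)) \<bar>t - 0\<bar> (par e ` {min t 0..max t 0})"
      using walk_seg[of e t 0] valid_bounds[OF assms, of e] by (simp add: param_0)
    moreover have "par e ` {min t 0..max t 0} \<subseteq> ?C" using low by (auto intro!: coded_low)
    ultimately show ?thesis using low by blast
  next
    case (high W' F' e t)
    then have "wlk p (Vx (snd e)) \<bar>t - len e\<bar> (par e ` {min t (len e)..max t (len e)})"
      using walk_seg[of e t "len e"] valid_bounds[OF assms, of e] len_pos[of e]
      by (simp add: param_len)
    moreover have "par e ` {min t (len e)..max t (len e)} \<subseteq> ?C"
      using high by (auto intro!: coded_high)
    ultimately show ?thesis using high by blast
  qed simp
  have edge: "\<exists>L S. wlk (Vx x) (Vx y) L S \<and> S \<subseteq> ?C" if "adj F x y" for x y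
  proof -
    obtain e where e: "e \<in> F" "e = (x, y) \<or> e = (y, x)" using \<open>adj F x y\<close> by (auto simp: adj_def)
    have e': "e \<in> E" "fst e \<in> W" "a e = len e" using assms e(1) by (auto simp: valid_def)
    have "wlk (Vx (fst e)) (Vx (snd e)) \<bar>0 - len e\<bar> (par e ` {min 0 (len e)..max 0 (len e)})"
      using walk_seg[of e 0 "len e"] len_pos[of e] e' by (simp add: param_len param_0)
    moreover have "par e ` {min 0 (len e)..max 0 (len e)} \<subseteq> ?C"
      using e' len_pos[of e] by (auto intro!: coded_low)
    ultimately show ?thesis using e(2) walk_rev by fastforce
  qed
  have vertices: "\<exists>L S. wlk (Vx u) (Vx w) L S \<and> S \<subseteq> ?C" if "u \<in> W" "w \<in> W" for u w
  proof -
    have "(adj F)\<^sup>*\<^sup>* u w" using assms that by (simp add: valid_def)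
    then show ?thesis
    proof (induction rule: rtranclp_induct)
      case base
      have "u \<in> V" using assms that by (auto simp: valid_def)
      then show ?case using walk_nil[of "Vx u"] coded_vertex[OF \<open>u \<in> W\<close>]
        by (intro exI[of _ 0] exI[of _ "{Vx u}"]) (auto simp: pts_def)
    next
      case (step y z)
      then show ?case using edge[of y z] walk_append by (meson Un_least)
    qed
  qed
  show ?thesis unfolding linked_def
  proof (intro ballI)
    fix p q assume pq: "p \<in> ?C" "q \<in> ?C"
    from to_vertex[OF pq(1)] to_vertex[OF pq(2)]
    obtain u w L1 S1 L2 S2 where *: "u \<in> W" "w \<in> W" "wlk p (Vx u) L1 S1" "S1 \<subseteq> ?C"
      "wlk q (Vx w) L2 S2" "S2 \<subseteq> ?C" by (elim bexE exE conjE)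
    from vertices[OF *(1,2)] obtain L S where "wlk (Vx u) (Vx w) L S" "S \<subseteq> ?C"
      by (elim exE conjE)
    then have "wlk p q (L1 + (L + L2)) (S1 \<union> (S \<union> S2))"
      using * by (intro walk_append walk_rev[of q]) auto
    then show "\<exists>L S. wlk p q L S \<and> S \<subseteq> ?C" using * \<open>S \<subseteq> ?C\<close> by (meson Un_least)
  qed
qed

lemma coded_connected_piece:
  assumes "valid \<tau> a b" shows "connected_piece V E len (coded \<tau> a b)"
proof -
  have "linked (coded \<tau> a b)"
  proof (cases \<tau>)
    case (Inl e)
    have e: "e \<in> E" "0 \<le> a e" "b e \<le> len e"
      using assms valid_bounds[OF assms] by (auto simp: valid_def Inl)
    show ?thesis unfolding linked_def
    proof (intro ballI)
      fix p q assume "p \<in> coded \<tau> a b" "q \<in> coded \<tau> a b"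
      then obtain t t' where t: "p = par e t" "a e \<le> t" "t \<le> b e"
        "q = par e t'" "a e \<le> t'" "t' \<le> b e" by (auto simp: coded_def Inl)
      then have "par e ` {min t t'..max t t'} \<subseteq> coded \<tau> a b"
        unfolding Inl by (auto intro!: coded_interval)
      moreover have "wlk p q \<bar>t - t'\<bar> (par e ` {min t t'..max t t'})"
        unfolding t(1,4) using t e by (intro walk_seg) auto
      ultimately show "\<exists>L S. wlk p q L S \<and> S \<subseteq> coded \<tau> a b" by blast
    qed
  next
    case (Inr y)
    then show ?thesis using coded_tree_linked assms by (cases y) auto
  qed
  then show ?thesis using coded_piece[OF assms] by (simp add: connected_piece_alt)
qed

text \<open>A point on an edge moves to the nearest parameter that the new code admits there, at
  most as far as the bounds have moved; vertices of \<open>W\<close> stay in place.\<close>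

lemma coded_perturb:
  assumes "valid \<tau> a b" "valid \<tau> a' b'"
    and close: "\<And>e. e \<in> E \<Longrightarrow> \<bar>a e - a' e\<bar> < \<delta> \<and> \<bar>b e - b' e\<bar> < \<delta>" and "0 < \<delta>"
    and "p \<in> coded \<tau> a b"
  shows "\<exists>q\<in>coded \<tau> a' b'. \<exists>L S. wlk p q L S \<and> L < \<delta>"
proof -
  have seg: "\<exists>L S. wlk (par e t) (par e t') L S \<and> L < \<delta>"
    if "e \<in> E" "0 \<le> t" "t \<le> len e" "0 \<le> t'" "t' \<le> len e" "\<bar>t - t'\<bar> < \<delta>" for e t t'
    using walk_seg[OF that(1-5)] that(6) by blast
  from assms(1,5) show ?thesis
  proof (cases rule: coded_cases)
    case (interval e t)
    \<comment> \<open>The parameter \<open>t\<close> clamped to the new interval, which validity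
      keeps nonempty.\<close>
    let ?t = "max (a' e) (min t (b' e))"
    have bd: "a' e \<le> b' e" "0 \<le> a e" "b e \<le> len e" "0 \<le> a' e" "b' e \<le> len e"
      using assms(2) valid_bounds[OF assms(1)] valid_bounds[OF assms(2)] interval
      by (auto simp: valid_def)
    have "\<bar>t - ?t\<bar> < \<delta>" using close[of e] interval \<open>0 < \<delta>\<close> bd by auto
    then have "\<exists>L S. wlk p (par e ?t) L S \<and> L < \<delta>"
      unfolding interval(3) using interval bd by (intro seg) auto
    moreover have "par e ?t \<in> coded \<tau> a' b'"
      unfolding interval(1) using bd by (intro coded_interval) auto
    ultimately show ?thesis by blast
  next
    case (vertex W F u)
    have "wlk p p 0 {p}" using vertex by (intro walk_nil) (simp add: pts_def)
    moreover have "p \<in> coded \<tau> a' b'" using vertex coded_vertex by simp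
    ultimately show ?thesis using \<open>0 < \<delta>\<close> by blast
  next
    case (low W F e t)
    let ?t = "min t (a' e)"
    have bd: "a e \<le> len e" "0 \<le> a' e" "a' e \<le> len e"
      using valid_bounds[OF assms(1)] valid_bounds[OF assms(2)] low by auto
    have "\<bar>t - ?t\<bar> < \<delta>" using close[of e] low \<open>0 < \<delta>\<close> by auto
    then have "\<exists>L S. wlk p (par e ?t) L S \<and> L < \<delta>"
      unfolding low(4) using low bd by (intro seg) auto
    moreover have "par e ?t \<in> coded \<tau> a' b'"
      unfolding low(1) using low bd by (intro coded_low) auto
    ultimately show ?thesis by blast
  next
    case (high W F e t)
    let ?t = "max t (b' e)"
    have bd: "0 \<le> b e" "0 \<le> b' e" "b' e \<le> len e"
      using valid_bounds[OF assms(1)] valid_bounds[OF assms(2)] high by auto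
    have "\<bar>t - ?t\<bar> < \<delta>" using close[of e] high \<open>0 < \<delta>\<close> by auto
    then have "\<exists>L S. wlk p (par e ?t) L S \<and> L < \<delta>"
      unfolding high(4) using high bd by (intro seg) auto
    moreover have "par e ?t \<in> coded \<tau> a' b'"
      unfolding high(1) using high bd by (intro coded_high) auto
    ultimately show ?thesis by blast
  qed
qed

lemma coded_diff_between:
  assumes "e \<in> E" "t \<in> on_edge len e (coded \<tau> a b)" "t \<notin> on_edge len e (coded \<tau> a' b')"
  shows "t \<in> {min (a e) (a' e)..max (a e) (a' e)} \<union> {min (b e) (b' e)..max (b e) (b' e)}"
proof (cases \<tau>)
  case (Inl e')
  then show ?thesis using assms by (auto simp: on_edge_coded_interval split: if_splits)
next
  case (Inr y)
  then obtain W F where "\<tau> = Inr (W, F)" by (cases y) auto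
  then show ?thesis using assms by (auto simp: on_edge_coded_tree split: if_splits)
qed

lemma measure_lborel_le:
  assumes "S \<subseteq> {min x x'..max x x'} \<union> {min y y'..max y y'}"
  shows "measure lborel S \<le> \<bar>x - x'\<bar> + \<bar>y - y'\<bar>"
proof (cases "S \<in> sets lborel")
  case True
  let ?A = "{min x x'..max x x'}" and ?B = "{min y y'..max y y'}"
  have AB: "?A \<in> fmeasurable lborel" "?B \<in> fmeasurable lborel"
    by (auto simp: fmeasurable_def)
  have "measure lborel S \<le> measure lborel (?A \<union> ?B)"
    using True assms AB by (intro measure_mono_fmeasurable) auto
  also have "\<dots> \<le> measure lborel ?A + measure lborel ?B"
    by (intro measure_Un_le) auto
  also have "\<dots> = \<bar>x - x'\<bar> + \<bar>y - y'\<bar>" by (simp add: min_def max_def)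
  finally show ?thesis .
next
  case False
  \<comment> \<open>By convention \<open>measure\<close> is 0 on non-measurable sets.\<close>
  then show ?thesis by (simp add: measure_notin_sets)
qed

lemma coded_plen_diff:
  "plen E len ((coded \<tau> a b - coded \<tau> a' b') \<union> (coded \<tau> a' b' - coded \<tau> a b))
    \<le> (\<Sum>e\<in>E. \<bar>a e - a' e\<bar> + \<bar>b e - b' e\<bar>)"
  unfolding plen_def
proof (intro sum_mono measure_lborel_le subsetI)
  fix e t
  assume e: "e \<in> E"
    and "t \<in> on_edge len e ((coded \<tau> a b - coded \<tau> a' b') \<union> (coded \<tau> a' b' - coded \<tau> a b))"
  then have "(t \<in> on_edge len e (coded \<tau> a b) \<and> t \<notin> on_edge len e (coded \<tau> a' b')) \<or>
    (t \<in> on_edge len e (coded \<tau> a' b') \<and> t \<notin> on_edge len e (coded \<tau> a b))"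
    by (auto simp: on_edge_def)
  then show "t \<in> {min (a e) (a' e)..max (a e) (a' e)} \<union> {min (b e) (b' e)..max (b e) (b' e)}"
    using coded_diff_between[OF e, of t \<tau> a b a' b'] coded_diff_between[OF e, of t \<tau> a' b' a b]
    by (auto simp: min.commute max.commute)
qed

lemma valid_limit:
  assumes val: "\<And>m. valid \<tau> (a m) (b m)"
    and lim: "\<And>e. e \<in> E \<Longrightarrow> (\<lambda>m. a m e) \<longlonglongrightarrow> a' e" "\<And>e. e \<in> E \<Longrightarrow> (\<lambda>m. b m e) \<longlonglongrightarrow> b' e"
  shows "valid \<tau> a' b'"
proof -
  have 1: "\<forall>e\<in>E. 0 \<le> a' e \<and> a' e \<le> len e \<and> 0 \<le> b' e \<and> b' e \<le> len e"
    using lim valid_bounds[OF val] by (meson LIMSEQ_le_const LIMSEQ_le_const2)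
  show ?thesis
  proof (cases \<tau>)
    case (Inl e)
    then have "e \<in> E" "\<And>m. a m e \<le> b m e" using val by (auto simp: valid_def)
    then show ?thesis using 1 lim Inl LIMSEQ_le[of "\<lambda>m. a m e" "a' e" "\<lambda>m. b m e" "b' e"]
      by (auto simp: valid_def)
  next
    case (Inr y)
    then obtain W F where \<tau>: "\<tau> = Inr (W, F)" by (cases y) auto
    have "a' e = len e" if "e \<in> F" for e
    proof -
      have "e \<in> E" "a m e = len e" for m using val[of m] that by (auto simp: valid_def \<tau>)
      then show ?thesis using lim(1)[of e] by (simp add: LIMSEQ_const_iff)
    qed
    \<comment> \<open>The remaining conditions concern the type alone and can be read off at any
      index.\<close>
    then show ?thesis using 1 val[of 0] by (auto simp: valid_def \<tau>)
  qed
qed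

section \<open>Enclosing a connected piece between a closed code and its closure\<close>

lemma walk_from_interior:
  assumes "wlk p r L S" "p = Ep e t" "0 < t" "t < len e"
  shows "par e ` {0..t} \<subseteq> S \<or> par e ` {t..len e} \<subseteq> S \<or>
    (\<exists>t'. r = Ep e t' \<and> par e ` {min t t'..max t t'} \<subseteq> S)"
  using assms
proof (induction arbitrary: t)
  case (walk_nil p)
  then show ?case by (auto simp: param_interior)
next
  case (walk_step e' a b r L S)
  have e': "e' = e" "a = t" using walk_step.prems(1) by (auto simp: param_eq_Ep)
  let ?s = "par e ` {min t b..max t b}"
  have glue: "par e ` {x..y} \<subseteq> par e ` {min t b..max t b} \<union> S"
    if "par e ` {min b x..max b y} \<subseteq> S" "{x..y} \<subseteq> {min t b..max t b} \<union> {min b x..max b y}" for x y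
    using that by blast
  consider "b = 0" | "b = len e" | "0 < b" "b < len e"
    using walk_step(4,5) e' by force
  then show ?case
  proof cases
    case 1
    then have "par e ` {0..t} \<subseteq> ?s" by auto
    then show ?thesis unfolding e' by blast
  next
    case 2
    then have "par e ` {t..len e} \<subseteq> ?s" by auto
    then show ?thesis unfolding e' by blast
  next
    case 3
    then have "par e' b = Ep e b" using e' by (simp add: param_interior)
    from walk_step.IH[OF this 3]
    consider "par e ` {0..b} \<subseteq> S" | "par e ` {b..len e} \<subseteq> S"
      | t' where "r = Ep e t'" "par e ` {min b t'..max b t'} \<subseteq> S" by blast
    then show ?thesis
    proof cases
      case 1
      have "{0..t} \<subseteq> {min t b..max t b} \<union> {0..b}" by auto
      then have "par e ` {0..t} \<subseteq> ?s \<union> S" using 1 by blast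
      then show ?thesis unfolding e' by blast
    next
      case 2
      have "{t..len e} \<subseteq> {min t b..max t b} \<union> {b..len e}" by auto
      then have "par e ` {t..len e} \<subseteq> ?s \<union> S" using 2 by blast
      then show ?thesis unfolding e' by blast
    next
      case (3 t')
      have "{min t t'..max t t'} \<subseteq> {min t b..max t b} \<union> {min b t'..max b t'}" by auto
      then have "par e ` {min t t'..max t t'} \<subseteq> ?s \<union> S" using 3 by blast
      then show ?thesis using 3(1) unfolding e' by blast
    qed
  qed
qed

text \<open>Membership in the closure of \<open>X\<close> for the path metric.\<close>

definition near :: "'v point set \<Rightarrow> 'v point \<Rightarrow> bool" where
  "near X p \<longleftrightarrow> (\<forall>\<epsilon>>0. \<exists>q\<in>X. \<exists>L S. wlk p q L S \<and> L < \<epsilon>)"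

lemma near_self: "p \<in> X \<Longrightarrow> p \<in> pts V E len \<Longrightarrow> near X p"
  unfolding near_def using walk_nil by blast

lemma near_edge:
  assumes "e \<in> E" "0 \<le> t" "t \<le> len e"
    and "\<And>\<epsilon>. 0 < \<epsilon> \<Longrightarrow> \<exists>t'. 0 \<le> t' \<and> t' \<le> len e \<and> \<bar>t - t'\<bar> < \<epsilon> \<and> par e t' \<in> X"
  shows "near X (par e t)"
  unfolding near_def
proof (intro allI impI)
  fix \<epsilon> :: real assume "0 < \<epsilon>"
  then obtain t' where t': "0 \<le> t'" "t' \<le> len e" "\<bar>t - t'\<bar> < \<epsilon>" "par e t' \<in> X"
    using assms(4) by blast
  then show "\<exists>q\<in>X. \<exists>L S. wlk (par e t) q L S \<and> L < \<epsilon>"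
    using walk_seg[OF assms(1-3) t'(1,2)] by blast
qed

text \<open>Supplies the connectedness witness \<open>F\<close> of a code. Walks may stop or turn
  back inside an edge, so the claim about vertices is not inductive alone. For an interior start the
  second conjunct records an end of the edge that is reached inside \<open>X\<close> and is joined
  to \<open>w\<close> by full edges.\<close>

lemma full_edges_connect:
  assumes F: "F = {e \<in> E. par e ` {0..len e} \<subseteq> X}"
    and "wlk p (Vx w) L S" "S \<subseteq> X"
  shows "(\<forall>u. p = Vx u \<longrightarrow> (adj F)\<^sup>*\<^sup>* u w) \<and>
    (\<forall>e t. e \<in> E \<longrightarrow> p = Ep e t \<longrightarrow>
      par e ` {0..t} \<subseteq> X \<and> (adj F)\<^sup>*\<^sup>* (fst e) w \<or>
      par e ` {t..len e} \<subseteq> X \<and> (adj F)\<^sup>*\<^sup>* (snd e) w)"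
  using assms(2,3)
proof (induction p "Vx w" L S)
  case (walk_nil)
  then show ?case by auto
next
  case (walk_step e a b L S)
  let ?s = "par e ` {min a b..max a b}"
  have s: "?s \<subseteq> X" using walk_step.prems by blast
  then have bX: "par e b \<in> X" "par e a \<in> X" by auto
  have "S \<subseteq> X" using walk_step.prems by blast
  note IH = conjunct1[OF walk_step.hyps(7)[OF this], rule_format]
    conjunct2[OF walk_step.hyps(7)[OF this], rule_format, OF walk_step.hyps(1)]
  \<comment> \<open>One dichotomy for every position \<open>b\<close>: at an end of the edge the
    corresponding segment degenerates to that vertex.\<close>
  have Hb: "par e ` {0..b} \<subseteq> X \<and> (adj F)\<^sup>*\<^sup>* (fst e) w \<or>
      par e ` {b..len e} \<subseteq> X \<and> (adj F)\<^sup>*\<^sup>* (snd e) w"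
  proof -
    consider "b = 0" | "b = len e" | "0 < b" "b < len e"
      using walk_step.hyps(4,5) by force
    then show ?thesis
    proof cases
      case 1
      then show ?thesis using IH(1)[of "fst e"] bX(1) by (simp add: param_0)
    next
      case 2
      then show ?thesis using IH(1)[of "snd e"] bX(1) walk_step.hyps(1) by (simp add: param_len)
    next
      case 3
      then show ?thesis by (intro IH(2)) (simp add: param_interior)
    qed
  qed
  have "{0..a} \<subseteq> {min a b..max a b} \<union> {0..b}" "{a..len e} \<subseteq> {min a b..max a b} \<union> {b..len e}"
    by auto
  then have "par e ` {0..a} \<subseteq> ?s \<union> par e ` {0..b}" "par e ` {a..len e} \<subseteq> ?s \<union> par e ` {b..len e}"
    by blast+
  then have Ha: "par e ` {0..a} \<subseteq> X \<and> (adj F)\<^sup>*\<^sup>* (fst e) w \<or>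
      par e ` {a..len e} \<subseteq> X \<and> (adj F)\<^sup>*\<^sup>* (snd e) w"
    using Hb s by blast
  show ?case
  proof (intro conjI allI impI)
    fix u assume "par e a = Vx u"
    then consider "a = 0" "u = fst e" | "a = len e" "u = snd e"
      using param_eq_Vx[OF walk_step.hyps(1-3)] by blast
    then show "(adj F)\<^sup>*\<^sup>* u w"
    proof cases
      case 1
      \<comment> \<open>If the alternative in \<open>Ha\<close> leads to the opposite end, then the
        whole edge lies in \<open>X\<close> and belongs to \<open>F\<close>.\<close>
      have "adj F u (snd e)" if "par e ` {0..len e} \<subseteq> X"
        using that 1 F walk_step.hyps(1) by (auto simp: adj_def)
      then show ?thesis using Ha 1 by (metis converse_rtranclp_into_rtranclp)
    next
      case 2
      have "adj F u (fst e)" if "par e ` {0..len e} \<subseteq> X"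
        using that 2 F walk_step.hyps(1) by (auto simp: adj_def)
      then show ?thesis using Ha 2 by (metis converse_rtranclp_into_rtranclp)
    qed
  next
    fix e' t assume "par e a = Ep e' t"
    then have "e' = e" "t = a" by (auto simp: param_eq_Ep)
    then show "par e' ` {0..t} \<subseteq> X \<and> (adj F)\<^sup>*\<^sup>* (fst e') w \<or>
      par e' ` {t..len e'} \<subseteq> X \<and> (adj F)\<^sup>*\<^sup>* (snd e') w" using Ha by simp
  qed
qed

text \<open>Each point of \<open>X\<close> inside an edge is joined to a vertex within
  \<open>X\<close>, so \<open>X\<close> contains the segment from it to one end of the edge. On
  every edge \<open>X\<close> is thus an initial and a final segment, either possibly missing. Their
  bounds need not be attained, so the code is only contained in the closure of \<open>X\<close>. The
  empty piece is included, with \<open>W\<close> empty.\<close>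

lemma cover_tree:
  assumes lk: "linked X" and X: "X \<subseteq> pts V E len" and vx: "X \<noteq> {} \<Longrightarrow> \<exists>u. Vx u \<in> X"
  shows "\<exists>\<tau> a b. valid \<tau> a b \<and> X \<subseteq> coded \<tau> a b \<and> (\<forall>p\<in>coded \<tau> a b. near X p)"
proof -
  define W where "W = {u. Vx u \<in> X}"
  define F where "F = {e \<in> E. par e ` {0..len e} \<subseteq> X}"
  define A where "A e = {t. 0 \<le> t \<and> t \<le> len e \<and> par e ` {0..t} \<subseteq> X}" for e
  define B where "B e = {t. 0 \<le> t \<and> t \<le> len e \<and> par e ` {t..len e} \<subseteq> X}" for e
  \<comment> \<open>The defaults satisfy the bounds in \<open>valid\<close>; \<open>coded\<close>
    reads \<open>a e\<close> only when \<open>fst e\<close> is in \<open>W\<close>, and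
    \<open>b e\<close> only when \<open>snd e\<close> is.\<close>
  define a where "a e = (if fst e \<in> W then Sup (A e) else 0)" for e
  define b where "b e = (if snd e \<in> W then Inf (B e) else len e)" for e
  have bddA: "bdd_above (A e)" and bddB: "bdd_below (B e)" for e
    by (auto simp: A_def B_def bdd_above_def bdd_below_def)
  have A0: "0 \<in> A e" if "e \<in> E" "fst e \<in> W" for e
    using that len_pos[of e] by (auto simp: A_def W_def param_0)
  have B0: "len e \<in> B e" if "e \<in> E" "snd e \<in> W" for e
    using that len_pos[of e] by (auto simp: B_def W_def param_len)
  have A_bound: "0 \<le> a e \<and> a e \<le> len e" if "e \<in> E" for e
  proof (cases "fst e \<in> W")
    case True
    have "Sup (A e) \<le> len e" using A0[OF that True] by (intro cSup_least) (auto simp: A_def)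
    then show ?thesis using cSup_upper[OF A0[OF that True] bddA] True by (simp add: a_def)
  qed (use len_pos[OF that] in \<open>simp add: a_def\<close>)
  have B_bound: "0 \<le> b e \<and> b e \<le> len e" if "e \<in> E" for e
  proof (cases "snd e \<in> W")
    case True
    have "0 \<le> Inf (B e)" using B0[OF that True] by (intro cInf_greatest) (auto simp: B_def)
    then show ?thesis using cInf_lower[OF B0[OF that True] bddB] True by (simp add: b_def)
  qed (use len_pos[OF that] in \<open>simp add: b_def\<close>)
  have "fst e \<in> W \<and> snd e \<in> W \<and> a e = len e" if "e \<in> F" for e
  proof -
    have e: "e \<in> E" "par e ` {0..len e} \<subseteq> X" using that by (auto simp: F_def)
    have "par e 0 \<in> X" "par e (len e) \<in> X" using e(2) len_pos[OF e(1)] by auto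
    then have W: "fst e \<in> W" "snd e \<in> W" using e(1) by (simp_all add: W_def param_0 param_len)
    have "len e \<in> A e" using e len_pos[of e] by (simp add: A_def)
    then have "len e \<le> Sup (A e)" using bddA by (rule cSup_upper)
    then show ?thesis using W A_bound[OF e(1)] by (simp add: a_def)
  qed
  moreover have "(adj F)\<^sup>*\<^sup>* u w" if "u \<in> W" "w \<in> W" for u w
  proof -
    have "Vx u \<in> X" "Vx w \<in> X" using that by (simp_all add: W_def)
    then obtain L S where "wlk (Vx u) (Vx w) L S" "S \<subseteq> X"
      using lk unfolding linked_def by blast
    then show ?thesis using full_edges_connect[OF F_def] by blast
  qed
  moreover have "W \<subseteq> V" using X by (auto simp: W_def pts_def)
  ultimately have val: "valid (Inr (W, F)) a b"
    using A_bound B_bound by (auto simp: valid_def F_def)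
  have "X \<subseteq> coded (Inr (W, F)) a b"
  proof
    fix p assume p: "p \<in> X"
    then have "p \<in> pts V E len" using X by blast
    then show "p \<in> coded (Inr (W, F)) a b"
    proof (cases rule: pts_cases)
      case (vertex u)
      then show ?thesis using p coded_vertex[of u W] by (simp add: W_def)
    next
      case (edge e t)
      obtain w L S where w: "wlk p (Vx w) L S" "S \<subseteq> X"
        using vx p lk unfolding linked_def by blast
      have t: "0 \<le> t" "t \<le> len e" using edge by auto
      from walk_from_interior[OF w(1) edge(4,2,3)] w(2)
      consider "par e ` {0..t} \<subseteq> X" | "par e ` {t..len e} \<subseteq> X" by blast
      then have "par e t \<in> coded (Inr (W, F)) a b"
      proof cases
        case 1
        then have "par e 0 \<in> X" using t by auto
        then have W: "fst e \<in> W" by (simp add: W_def param_0)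
        have "t \<in> A e" using 1 t by (simp add: A_def)
        then have "t \<le> a e" using cSup_upper[OF _ bddA] W by (simp add: a_def)
        then show ?thesis using coded_low edge(1) W t by blast
      next
        case 2
        then have "par e (len e) \<in> X" using t by auto
        then have W: "snd e \<in> W" using edge(1) by (simp add: W_def param_len)
        have "t \<in> B e" using 2 t by (simp add: B_def)
        then have "b e \<le> t" using cInf_lower[OF _ bddB] W by (simp add: b_def)
        then show ?thesis using coded_high edge(1) W t by blast
      qed
      then show ?thesis using edge by (simp add: param_interior)
    qed
  qed
  moreover have "near X p" if p: "p \<in> coded (Inr (W, F)) a b" for p
    using val p
  proof (cases rule: coded_cases)
    case (vertex W' F' u)
    then show ?thesis using near_self X by (auto simp: W_def)
  next
    case (low W' F' e t)
    have W: "fst e \<in> W" and t: "0 \<le> t" "t \<le> len e" "t \<le> Sup (A e)"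
      using low A_bound[OF low(2)] by (auto simp: a_def)
    have "\<exists>t'. 0 \<le> t' \<and> t' \<le> len e \<and> \<bar>t - t'\<bar> < \<epsilon> \<and> par e t' \<in> X" if "0 < \<epsilon>" for \<epsilon>
    proof -
      have "t - \<epsilon> < Sup (A e)" using t that by linarith
      then obtain x where x: "x \<in> A e" "t - \<epsilon> < x"
        using less_cSup_iff[OF _ bddA] A0[OF low(2) W] by blast
      \<comment> \<open>All parameters up to \<open>x\<close> belong to \<open>X\<close>, and
        \<open>min x t\<close> is either \<open>t\<close> itself or less than
        \<open>\<epsilon>\<close> below it.\<close>
      have "par e (min x t) \<in> X" using x(1) t by (auto simp: A_def)
      then show ?thesis using x t that
        by (intro exI[of _ "min x t"]) (auto simp: A_def)
    qed
    then show ?thesis unfolding low(4) using low(2) t by (intro near_edge) auto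
  next
    case (high W' F' e t)
    have W: "snd e \<in> W" and t: "0 \<le> t" "t \<le> len e" "Inf (B e) \<le> t"
      using high B_bound[OF high(2)] by (auto simp: b_def)
    have "\<exists>t'. 0 \<le> t' \<and> t' \<le> len e \<and> \<bar>t - t'\<bar> < \<epsilon> \<and> par e t' \<in> X" if "0 < \<epsilon>" for \<epsilon>
    proof -
      have "Inf (B e) < t + \<epsilon>" using t that by linarith
      then obtain x where x: "x \<in> B e" "x < t + \<epsilon>"
        using cInf_less_iff[OF _ bddB] B0[OF high(2) W] by blast
      have "par e (max x t) \<in> X" using x(1) t by (auto simp: B_def)
      then show ?thesis using x t that
        by (intro exI[of _ "max x t"]) (auto simp: B_def)
    qed
    then show ?thesis unfolding high(4) using high(2) t by (intro near_edge) auto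
  qed simp
  ultimately show ?thesis using val by blast
qed

text \<open>A walk that leaves an edge passes one of its ends. Without vertices, \<open>X\<close> is
  therefore confined to one edge and convex there, and the code is the closed interval with the same
  bounds.\<close>

lemma cover_interval:
  assumes lk: "linked X" and X: "X \<subseteq> pts V E len" "X \<noteq> {}" and vx: "\<And>u. Vx u \<notin> X"
  shows "\<exists>\<tau> a b. valid \<tau> a b \<and> X \<subseteq> coded \<tau> a b \<and> (\<forall>p\<in>coded \<tau> a b. near X p)"
proof -
  obtain p0 where p0: "p0 \<in> X" using X by blast
  then have "p0 \<in> pts V E len" using X by blast
  then obtain e t0 where e: "e \<in> E" "0 < t0" "t0 < len e" "p0 = Ep e t0"
    using p0 vx by (cases rule: pts_cases) auto
  have seg: "\<exists>t'. q = Ep e t' \<and> par e ` {min t t'..max t t'} \<subseteq> X"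
    if t: "Ep e t \<in> X" "0 < t" "t < len e" and q: "q \<in> X" for t q
  proof -
    obtain L S where w: "wlk (Ep e t) q L S" "S \<subseteq> X"
      using lk t(1) q unfolding linked_def by blast
    have "par e 0 \<in> par e ` {0..t}" "par e (len e) \<in> par e ` {t..len e}" using t by auto
    then have "\<not> par e ` {0..t} \<subseteq> X" "\<not> par e ` {t..len e} \<subseteq> X"
      using vx e(1) by (auto simp: param_0 param_len)
    then show ?thesis using walk_from_interior[OF w(1) refl t(2,3)] w(2) by blast
  qed
  define T where "T = {t. Ep e t \<in> X}"
  have T: "0 < t \<and> t < len e" if "t \<in> T" for t using that X by (auto simp: T_def pts_def)
  have XT: "q \<in> Ep e ` T" if "q \<in> X" for q
  proof -
    have "Ep e t0 \<in> X" using p0 e(4) by simp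
    from seg[OF this e(2,3) that] obtain t' where "q = Ep e t'" by (elim exE conjE)
    then show ?thesis using that by (auto simp: T_def)
  qed
  have conv: "t \<in> T" if "t1 \<in> T" "t2 \<in> T" "t1 \<le> t" "t \<le> t2" for t t1 t2
  proof -
    have "par e ` {min t1 t2..max t1 t2} \<subseteq> X"
      using seg[of t1 "Ep e t2"] T[OF that(1)] that(1,2) by (auto simp: T_def)
    then have "par e t \<in> X" using that(3,4) by auto
    moreover have "0 < t" "t < len e" using T[OF that(1)] T[OF that(2)] that by auto
    ultimately show ?thesis by (simp add: T_def param_interior)
  qed
  have t0: "t0 \<in> T" using p0 e by (simp add: T_def)
  have bdd: "bdd_above T" "bdd_below T"
    using T by (auto simp: bdd_above_def bdd_below_def intro: less_imp_le)
  define a where "a e' = (if e' = e then Inf T else 0)" for e'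
  define b where "b e' = (if e' = e then Sup T else 0)" for e'
  have ab: "0 \<le> Inf T" "Inf T \<le> t0" "t0 \<le> Sup T" "Sup T \<le> len e"
    subgoal by (rule cInf_greatest) (use t0 T in \<open>auto intro: less_imp_le\<close>)
    subgoal by (rule cInf_lower[OF t0 bdd(2)])
    subgoal by (rule cSup_upper[OF t0 bdd(1)])
    subgoal by (rule cSup_least) (use t0 T in \<open>auto intro: less_imp_le\<close>)
    done
  then have val: "valid (Inl e) a b"
    using e len_pos by (auto simp: valid_def a_def b_def less_imp_le)
  have sub: "X \<subseteq> coded (Inl e) a b"
  proof
    fix q assume "q \<in> X"
    then obtain t where t: "q = Ep e t" "t \<in> T" using XT by blast
    then have "a e \<le> t" "t \<le> b e" using bdd by (auto simp: a_def b_def intro: cInf_lower cSup_upper)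
    then have "par e t \<in> coded (Inl e) a b" by (rule coded_interval)
    then show "q \<in> coded (Inl e) a b" using t T by (simp add: param_interior)
  qed
  have "near X p" if p: "p \<in> coded (Inl e) a b" for p
  proof -
    obtain t where t: "p = par e t" "Inf T \<le> t" "t \<le> Sup T"
      using p by (auto simp: coded_def a_def b_def)
    have "\<exists>t'. 0 \<le> t' \<and> t' \<le> len e \<and> \<bar>t - t'\<bar> < \<epsilon> \<and> par e t' \<in> X" if \<epsilon>: "0 < \<epsilon>" for \<epsilon>
    proof -
      obtain t1 where t1: "t1 \<in> T" "t1 < t + \<epsilon>"
        using cInf_less_iff[of T "t + \<epsilon>"] bdd t0 t \<epsilon> by force
      obtain t2 where t2: "t2 \<in> T" "t - \<epsilon> < t2"
        using less_cSup_iff[of T "t - \<epsilon>"] bdd t0 t \<epsilon> by force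
      have "\<exists>t'\<in>T. \<bar>t - t'\<bar> < \<epsilon>"
      proof -
        \<comment> \<open>If neither \<open>t1\<close> nor \<open>t2\<close> is known to be close to
          \<open>t\<close>, then \<open>t\<close> lies between them and belongs to \<open>T\<close>
          by convexity.\<close>
        consider "t < t1" | "t2 < t" | "t1 \<le> t" "t \<le> t2" by linarith
        then show ?thesis
        proof cases
          case 1
          then have "\<bar>t - t1\<bar> < \<epsilon>" using t1 by linarith
          then show ?thesis using t1 by blast
        next
          case 2
          then have "\<bar>t - t2\<bar> < \<epsilon>" using t2 by linarith
          then show ?thesis using t2 by blast
        next
          case 3
          then show ?thesis using conv[OF t1(1) t2(1)] \<epsilon> by force
        qed
      qed
      then obtain t' where t': "t' \<in> T" "\<bar>t - t'\<bar> < \<epsilon>" by blast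
      then show ?thesis using T[of t'] by (auto simp: T_def param_interior intro!: exI[of _ t'])
    qed
    then show ?thesis unfolding t(1) using e(1) t ab by (intro near_edge) auto
  qed
  then show ?thesis using val sub by blast
qed

lemma cover:
  assumes "connected_piece V E len X"
  shows "\<exists>\<tau> a b. valid \<tau> a b \<and> X \<subseteq> coded \<tau> a b \<and> (\<forall>p\<in>coded \<tau> a b. near X p)"
proof (cases "X = {} \<or> (\<exists>u. Vx u \<in> X)")
  case True
  then show ?thesis
    using assms by (intro cover_tree) (auto simp: connected_piece_alt piece_def)
next
  case False
  then show ?thesis
    using assms by (intro cover_interval) (auto simp: connected_piece_alt piece_def)
qed

section \<open>Compactness for codes and partitions\<close>

definition code_types :: "(('v \<times> 'v) + 'v set \<times> ('v \<times> 'v) set) set" where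
  "code_types = Inl ` E \<union> Inr ` (Pow V \<times> Pow E)"

lemma finite_code_types: "finite code_types"
  using finite_V finite_E by (simp add: code_types_def)

lemma valid_code_type: "valid \<tau> a b \<Longrightarrow> \<tau> \<in> code_types"
  by (cases \<tau>) (auto simp: valid_def code_types_def)

text \<open>There are finitely many type vectors, so one recurs infinitely often; along it the
  bounded parameters of all parts and edges converge simultaneously for a further
  subsequence.\<close>

lemma code_subsequence:
  assumes val: "\<And>m j. j < k \<Longrightarrow> valid (\<tau> m j) (a m j) (b m j)"
  shows "\<exists>r \<sigma> a' b'. strict_mono (r :: nat \<Rightarrow> nat) \<and> (\<forall>j<(k::nat). (\<forall>m. \<tau> (r m) j = \<sigma> j) \<and>
    (\<forall>e\<in>E. (\<lambda>m. a (r m) j e) \<longlonglongrightarrow> a' j e \<and> (\<lambda>m. b (r m) j e) \<longlonglongrightarrow> b' j e))"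
proof -
  \<comment> \<open>Types at indices from \<open>k\<close> on are unconstrained; restricting to
    \<open>{..<k}\<close> makes the range finite.\<close>
  define T where "T m = restrict (\<tau> m) {..<k}" for m
  have "range T \<subseteq> PiE {..<k} (\<lambda>_. code_types)"
    unfolding T_def using valid_code_type[OF val]
    by (intro image_subsetI restrict_PiE_iff[THEN iffD2]) auto
  then have "finite (range T)"
    using finite_PiE[of "{..<k}" "\<lambda>_. code_types"] finite_code_types finite_subset by blast
  then obtain m0 where "infinite {m. T m = T m0}"
    using pigeonhole_infinite[of "UNIV :: nat set" T] by auto
  then obtain r where r: "strict_mono (r :: nat \<Rightarrow> nat)" "\<And>m. T (r m) = T m0"
    using infinite_enumerate[of "{m. T m = T m0}"] by blast
  define f where "f m i = (case i of (j, e, lower) \<Rightarrow> if lower then a (r m) j e else b (r m) j e)"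
    for m i
  have "\<bar>f m i\<bar> \<le> len (fst (snd i))" if i0: "i \<in> {..<k} \<times> E \<times> (UNIV :: bool set)" for m i
  proof -
    obtain j e l where i: "i = (j, e, l)" "j < k" "e \<in> E" using i0 by (metis SigmaE lessThan_iff)
    then show ?thesis using valid_bounds[OF val[OF i(2), of "r m"] i(3)] by (simp add: f_def)
  qed
  moreover have "finite ({..<k} \<times> E \<times> (UNIV :: bool set))" using finite_E by simp
  ultimately obtain r' l where r': "strict_mono (r' :: nat \<Rightarrow> nat)"
    "\<forall>i\<in>{..<k} \<times> E \<times> (UNIV :: bool set). (\<lambda>m. f (r' m) i) \<longlonglongrightarrow> l i"
    using common_convergent_subsequence[of "{..<k} \<times> E \<times> UNIV" f "\<lambda>i. len (fst (snd i))"] by blast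
  have "\<tau> ((r \<circ> r') m) j = \<tau> m0 j" if "j < k" for m j
    using fun_cong[OF r(2)[of "r' m"], of j] that by (simp add: T_def)
  moreover have "(\<lambda>m. a ((r \<circ> r') m) j e) \<longlonglongrightarrow> l (j, e, True)" if "j < k" "e \<in> E" for j e
    using bspec[OF r'(2), of "(j, e, True)"] that by (simp add: f_def)
  moreover have "(\<lambda>m. b ((r \<circ> r') m) j e) \<longlonglongrightarrow> l (j, e, False)" if "j < k" "e \<in> E" for j e
    using bspec[OF r'(2), of "(j, e, False)"] that by (simp add: f_def)
  moreover have "strict_mono (r \<circ> r')" using r(1) r'(1) by (rule strict_mono_o)
  ultimately show ?thesis
    by (intro exI[of _ "r \<circ> r'"] exI[of _ "\<tau> m0"] exI[of _ "\<lambda>j e. l (j, e, True)"]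
        exI[of _ "\<lambda>j e. l (j, e, False)"] conjI allI impI ballI)
qed

text \<open>The symmetric difference of two codes of one type is no longer than the total change of
  the parameters, and \<open>v\<close> is continuous with respect to that length.\<close>

lemma coded_limit_value:
  assumes v: "valuation V E len v"
    and val: "\<And>m. valid \<tau> (a m) (b m)" "valid \<tau> a' b'"
    and lim: "\<And>e. e \<in> E \<Longrightarrow> (\<lambda>m. a m e) \<longlonglongrightarrow> a' e" "\<And>e. e \<in> E \<Longrightarrow> (\<lambda>m. b m e) \<longlonglongrightarrow> b' e"
  shows "(\<lambda>m. v (coded \<tau> (a m) (b m))) \<longlonglongrightarrow> v (coded \<tau> a' b')"
proof (rule metric_LIMSEQ_I)
  fix \<epsilon> :: real assume "0 < \<epsilon>"
  let ?C = "\<lambda>m. coded \<tau> (a m) (b m)" and ?C' = "coded \<tau> a' b'"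
  obtain \<delta> where \<delta>: "0 < \<delta>" "\<And>Y. piece V E len Y \<Longrightarrow>
      plen E len ((?C' - Y) \<union> (Y - ?C')) < \<delta> \<Longrightarrow> \<bar>v Y - v ?C'\<bar> < \<epsilon>"
    using v coded_piece[OF val(2)] \<open>0 < \<epsilon>\<close> unfolding valuation_def by blast
  have "(\<lambda>m. \<Sum>e\<in>E. \<bar>a' e - a m e\<bar> + \<bar>b' e - b m e\<bar>)
      \<longlonglongrightarrow> (\<Sum>e\<in>E. \<bar>a' e - a' e\<bar> + \<bar>b' e - b' e\<bar>)"
    using lim by (intro tendsto_intros)
  then have "\<forall>\<^sub>F m in sequentially. (\<Sum>e\<in>E. \<bar>a' e - a m e\<bar> + \<bar>b' e - b m e\<bar>) < \<delta>"
    using \<delta>(1) by (intro order_tendstoD(2)) auto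
  then obtain M where M: "\<And>m. M \<le> m \<Longrightarrow> (\<Sum>e\<in>E. \<bar>a' e - a m e\<bar> + \<bar>b' e - b m e\<bar>) < \<delta>"
    unfolding eventually_sequentially by blast
  have "\<bar>v (?C m) - v ?C'\<bar> < \<epsilon>" if "M \<le> m" for m
    using \<delta>(2)[OF coded_piece[OF val(1)[of m]]] M[OF that] coded_plen_diff[of \<tau> a' b' "a m" "b m"]
    by linarith
  then show "\<exists>M. \<forall>m\<ge>M. dist (v (?C m)) (v ?C') < \<epsilon>" by (auto simp: dist_real_def)
qed

text \<open>The codes enter for their values and their limits, but distances in the limit are
  compared with those of the original parts, which the limit sets approximate.\<close>

lemma limit_partition:
  assumes "0 < s" and v: "valuation V E len v"
    and P: "\<And>m. separated V E len s k (P m)"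
    and x: "\<And>m j. j < k \<Longrightarrow> x - inverse (real (Suc m)) \<le> v (P m j)"
  shows "\<exists>Q. separated V E len s k Q \<and> (\<forall>j<k. x \<le> v (Q j))"
proof -
  have con: "connected_piece V E len (P m j)" if "j < k" for m j
    using P[of m] that by (simp add: separated_def)
  have "\<forall>m j. \<exists>\<tau> a b. j < k \<longrightarrow>
      valid \<tau> a b \<and> P m j \<subseteq> coded \<tau> a b \<and> (\<forall>p\<in>coded \<tau> a b. near (P m j) p)"
    using cover[OF con] by blast
  then have "\<exists>\<tau> a b. \<forall>m j. j < k \<longrightarrow> valid (\<tau> m j) (a m j) (b m j) \<and>
      P m j \<subseteq> coded (\<tau> m j) (a m j) (b m j) \<and>
      (\<forall>p\<in>coded (\<tau> m j) (a m j) (b m j). near (P m j) p)"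
    by (simp only: choice_iff)
  then obtain \<tau> a b where code: "\<And>m j. j < k \<Longrightarrow> valid (\<tau> m j) (a m j) (b m j)"
    "\<And>m j. j < k \<Longrightarrow> P m j \<subseteq> coded (\<tau> m j) (a m j) (b m j)"
    "\<And>m j p. j < k \<Longrightarrow> p \<in> coded (\<tau> m j) (a m j) (b m j) \<Longrightarrow> near (P m j) p"
    by blast
  have "\<exists>r \<sigma> a' b'. strict_mono (r :: nat \<Rightarrow> nat) \<and> (\<forall>j<k. (\<forall>m. \<tau> (r m) j = \<sigma> j) \<and>
    (\<forall>e\<in>E. (\<lambda>m. a (r m) j e) \<longlonglongrightarrow> a' j e \<and> (\<lambda>m. b (r m) j e) \<longlonglongrightarrow> b' j e))"
    using code(1) by (rule code_subsequence)
  then obtain r \<sigma> a' b' where r: "strict_mono (r :: nat \<Rightarrow> nat)"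
    and lim: "\<forall>j<k. (\<forall>m. \<tau> (r m) j = \<sigma> j) \<and>
      (\<forall>e\<in>E. (\<lambda>m. a (r m) j e) \<longlonglongrightarrow> a' j e \<and> (\<lambda>m. b (r m) j e) \<longlonglongrightarrow> b' j e)"
    by (elim exE conjE)
  have \<sigma>: "\<tau> (r m) j = \<sigma> j" if "j < k" for m j
    using lim that by simp
  have a': "(\<lambda>m. a (r m) j e) \<longlonglongrightarrow> a' j e" and b': "(\<lambda>m. b (r m) j e) \<longlonglongrightarrow> b' j e"
    if "j < k" "e \<in> E" for j e
    using lim that by simp_all
  define C where "C m j = coded (\<sigma> j) (a (r m) j) (b (r m) j)" for m j
  define Q where "Q j = coded (\<sigma> j) (a' j) (b' j)" for j
  have val: "valid (\<sigma> j) (a (r m) j) (b (r m) j)" if "j < k" for m j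
    using code(1)[OF that, of "r m"] \<sigma>[OF that] by simp
  have val': "valid (\<sigma> j) (a' j) (b' j)" if "j < k" for j
    using valid_limit[OF val[OF that] a'[OF that] b'[OF that]] .
  have ge: "x \<le> v (Q j)" if j: "j < k" for j
  proof -
    have "x - inverse (real (Suc m)) \<le> v (C m j)" for m
    proof -
      have "piece V E len (P (r m) j)" "piece V E len (C m j)" "P (r m) j \<subseteq> C m j"
        using con[OF j] coded_piece[OF val[OF j]] code(2)[OF j, of "r m"] \<sigma>[OF j]
        by (simp_all add: connected_piece_def C_def)
      then have "v (P (r m) j) \<le> v (C m j)" using v by (simp add: valuation_def)
      \<comment> \<open>A subsequence satisfies \<open>m \<le> r m\<close>, so the error at
        \<open>r m\<close> is no larger than the one at \<open>m\<close>.\<close>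
      moreover have "inverse (real (Suc (r m))) \<le> inverse (real (Suc m))"
        using seq_suble[OF r, of m] by (intro le_imp_inverse_le) auto
      ultimately show ?thesis using x[OF j, of "r m"] by linarith
    qed
    moreover have "(\<lambda>m. v (C m j)) \<longlonglongrightarrow> v (Q j)"
      unfolding C_def Q_def by (rule coded_limit_value[OF v val[OF j] val'[OF j] a'[OF j] b'[OF j]])
    moreover have "(\<lambda>m. x - inverse (real (Suc m))) \<longlonglongrightarrow> x - 0"
      by (intro tendsto_diff tendsto_const LIMSEQ_inverse_real_of_nat)
    ultimately show ?thesis using LIMSEQ_le by fastforce
  qed
  \<comment> \<open>One \<open>\<eta>\<close> pays for changing the parameters, the other for
    passing from the code to the part it encloses.\<close>
  have approx: "\<forall>\<^sub>F m in sequentially. \<exists>q\<in>P (r m) j. \<exists>L S. wlk p q L S \<and> L < 2 * \<eta>"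
    if j: "j < k" and p: "p \<in> Q j" and \<eta>: "0 < \<eta>" for j p and \<eta> :: real
  proof -
    have "\<forall>\<^sub>F m in sequentially. \<bar>a' j e - a (r m) j e\<bar> < \<eta> \<and> \<bar>b' j e - b (r m) j e\<bar> < \<eta>"
      if "e \<in> E" for e
    proof -
      have "\<forall>\<^sub>F m in sequentially. dist (a (r m) j e) (a' j e) < \<eta>"
        "\<forall>\<^sub>F m in sequentially. dist (b (r m) j e) (b' j e) < \<eta>"
        using tendstoD[OF a'[OF j that] \<eta>] tendstoD[OF b'[OF j that] \<eta>] by simp_all
      then show ?thesis
        by eventually_elim (simp add: dist_real_def abs_minus_commute)
    qed
    then have "\<forall>\<^sub>F m in sequentially. \<forall>e\<in>E.
        \<bar>a' j e - a (r m) j e\<bar> < \<eta> \<and> \<bar>b' j e - b (r m) j e\<bar> < \<eta>"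
      using finite_E by (intro eventually_ball_finite) auto
    then show ?thesis
    proof eventually_elim
      case (elim m)
      then obtain q L S where q: "q \<in> C m j" "wlk p q L S" "L < \<eta>"
        using coded_perturb[OF val'[OF j] val[OF j], of m \<eta> p] \<eta> p unfolding Q_def C_def by blast
      then have "near (P (r m) j) q"
        using code(3)[OF j, of q "r m"] \<sigma>[OF j] by (simp add: C_def)
      then obtain q' L' S' where "q' \<in> P (r m) j" "wlk q q' L' S'" "L' < \<eta>"
        using \<eta> unfolding near_def by blast
      moreover from this have "wlk p q' (L + L') (S \<union> S')" "L + L' < 2 * \<eta>"
        using q walk_append by auto
      ultimately show ?case by blast
    qed
  qed
  have "DistSet V E len (Q i) (Q j) \<ge> ereal s" if ij: "i < k" "j < k" "i \<noteq> j" for i j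
    unfolding DistSet_ge_iff
  proof (intro ballI allI impI, rule ccontr)
    fix p q L S assume pq: "p \<in> Q i" "q \<in> Q j" "wlk p q L S" "\<not> s \<le> L"
    \<comment> \<open>Each end of the walk is displaced by less than \<open>2 * \<eta>\<close>, so
      the new walk is shorter than \<open>L + 4 * \<eta> = s\<close>.\<close>
    define \<eta> where "\<eta> = (s - L) / 4"
    have \<eta>: "0 < \<eta>" using pq by (simp add: \<eta>_def)
    have "\<exists>m. (\<exists>p'\<in>P (r m) i. \<exists>L S. wlk p p' L S \<and> L < 2 * \<eta>) \<and>
        (\<exists>q'\<in>P (r m) j. \<exists>L S. wlk q q' L S \<and> L < 2 * \<eta>)"
      using eventually_conj[OF approx[OF ij(1) pq(1) \<eta>] approx[OF ij(2) pq(2) \<eta>]]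
      by (rule eventually_happens'[OF sequentially_bot])
    then obtain m p' q' L1 S1 L2 S2 where *: "p' \<in> P (r m) i" "wlk p p' L1 S1" "L1 < 2 * \<eta>"
      "q' \<in> P (r m) j" "wlk q q' L2 S2" "L2 < 2 * \<eta>" by blast
    have "wlk p' q' (L1 + (L + L2)) (S1 \<union> (S \<union> S2))"
      by (rule walk_append[OF walk_rev[OF *(2)] walk_append[OF pq(3) *(5)]])
    moreover have "DistSet V E len (P (r m) i) (P (r m) j) \<ge> ereal s"
      using P[of "r m"] ij by (simp add: separated_def)
    ultimately have "s \<le> L1 + (L + L2)" using * unfolding DistSet_ge_iff by blast
    moreover have "L1 + (L + L2) < s" using * by (simp add: \<eta>_def field_simps)
    ultimately show False by linarith
  qed
  moreover have "connected_piece V E len (Q j)" if "j < k" for j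
    unfolding Q_def by (rule coded_connected_piece[OF val'[OF that]])
  ultimately have "separated V E len s k Q" using separated_iff[OF \<open>0 < s\<close>] by blast
  then show ?thesis using ge by blast
qed

section \<open>Attainment of the maximin share\<close>

lemma pts_piece: "piece V E len (pts V E len)"
proof -
  have "on_edge len e (pts V E len) = {0<..<len e}" if "e \<in> E" for e
    using that by (cases e) (auto simp: on_edge_def pts_def)
  moreover have "finite_union_intervals {0<..<len e}" for e
    using finite_union_intervals_Un[of "{0<..<len e}" "{}"] by (simp add: is_interval_1)
  ultimately show ?thesis by (simp add: piece_def)
qed

lemma empty_connected_piece: "connected_piece V E len {}"
  using finite_union_intervals_Un[of "{}" "{}"]
  by (simp add: connected_piece_def piece_def on_edge_def)

text \<open>The supremum is a genuine one: empty parts, at infinite distance from each other, form a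
  separated partition, and the value of the whole cake is an upper bound. Partitions within
  \<open>1 / (m + 1)\<close> of the supremum then have a limit that attains it.\<close>

lemma MMS_attained:
  assumes "0 < s" "1 \<le> k" and v: "valuation V E len v"
  shows "\<exists>Q. separated V E len s k Q \<and> (\<forall>j<k. MMS V E len v k s \<le> v (Q j))"
proof -
  define X where "X = {Min ((\<lambda>j. v (P j)) ` {..<k}) | P. separated V E len s k P}"
  have "separated V E len s k (\<lambda>_. {})"
    by (simp add: separated_def empty_connected_piece DistSet_def)
  then have ne: "X \<noteq> {}" by (auto simp: X_def)
  have k: "0 \<in> {..<k}" using assms(2) by simp
  have "y \<le> v (pts V E len)" if "y \<in> X" for y
  proof -
    obtain P where P: "separated V E len s k P" "y = Min ((\<lambda>j. v (P j)) ` {..<k})"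
      using \<open>y \<in> X\<close> by (auto simp: X_def)
    have "piece V E len (P 0)" "P 0 \<subseteq> pts V E len"
      using P(1) k by (simp_all add: separated_def connected_piece_def piece_def)
    then have "v (P 0) \<le> v (pts V E len)" using v pts_piece by (simp add: valuation_def)
    moreover have "y \<le> v (P 0)" unfolding P(2) using k by (intro Min_le) auto
    ultimately show ?thesis by simp
  qed
  then have bdd: "bdd_above X" by (auto simp: bdd_above_def)
  have "\<exists>P. separated V E len s k P \<and> (\<forall>j<k. Sup X - inverse (real (Suc m)) \<le> v (P j))" for m
  proof -
    have "Sup X - inverse (real (Suc m)) < Sup X" by simp
    then obtain y where "y \<in> X" "Sup X - inverse (real (Suc m)) < y"
      using less_cSup_iff[OF ne bdd] by blast
    then obtain P where P: "separated V E len s k P"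
      "Sup X - inverse (real (Suc m)) < Min ((\<lambda>j. v (P j)) ` {..<k})" by (auto simp: X_def)
    have "Min ((\<lambda>j. v (P j)) ` {..<k}) \<le> v (P j)" if "j < k" for j
      using that by (intro Min_le) auto
    then show ?thesis using P by (meson less_imp_le order_trans)
  qed
  then obtain P where "\<And>m. separated V E len s k (P m)"
    "\<And>m j. j < k \<Longrightarrow> Sup X - inverse (real (Suc m)) \<le> v (P m j)" by metis
  then show ?thesis
    using limit_partition[OF assms(1) v, of k P "Sup X"] by (simp add: MMS_def X_def)
qed

section \<open>Selecting one part per agent\<close>

lemma separated_rainbow:
  fixes P :: "nat \<Rightarrow> nat \<Rightarrow> 'v point set"
  assumes "0 < s" "1 \<le> n"
    and N: "N = min (n + FvsNum V E) (2 * n - 1)"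
    and comp: "\<forall>x\<in>V. FvsNum (component V E x) E \<le> 1"
    and P: "\<And>i. i < n \<Longrightarrow> separated V E len s N (P i)"
  shows "\<exists>c. (\<forall>i<n. c i < N) \<and> separated V E len s n (\<lambda>i. P i (c i))"
proof -
  define B where "B i k = nbhd (s / 2) (P i k)" for i k
  have con: "connected_piece V E len (P i k)" if "i < n" "k < N" for i k
    using P[OF that(1)] that(2) by (simp add: separated_def)
  have lk: "linked (B i k)" if "i < n" "k < N" for i k
    unfolding B_def using con[OF that] \<open>0 < s\<close>
    by (intro linked_nbhd) (simp_all add: connected_piece_alt)
  have disj: "B i k \<inter> B i k' = {}" if "i < n" "k < N" "k' < N" "k \<noteq> k'" for i k k'
    using P[OF that(1)] that(2-4) unfolding B_def nbhd_disjoint_iff by (simp add: separated_def)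
  have "\<exists>c. \<forall>i<n. c i < N \<and> (\<forall>i'<n. i \<noteq> i' \<longrightarrow> B i (c i) \<inter> B i' (c i') = {})"
  \<comment> \<open>The case tells which bound equals \<open>N\<close>, and with it which feedback
    set is used: a minimum one for the whole graph, or one with at most one vertex in each
    component.\<close>
  proof (cases "n + FvsNum V E \<le> 2 * n - 1")
    case True
    obtain Z where Z: "Z \<subseteq> V" "card Z = FvsNum V E" "\<not> has_cycle (V - Z) E"
      using feedback_set by blast
    have "n + card Z \<le> N" using True Z(2) N by simp
    from rainbow_feedback_number[OF Z(1,3) lk disj this assms(2)] show ?thesis .
  next
    case False
    obtain Z where Z: "\<not> has_cycle (V - Z) E"
      "\<And>z z' L S. z \<in> Z \<Longrightarrow> z' \<in> Z \<Longrightarrow> wlk (Vx z) (Vx z') L S \<Longrightarrow> z = z'"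
      using component_feedback_set[OF comp] by metis
    have "2 * n - 1 \<le> N" using False N by simp
    from rainbow_components[OF Z lk disj this assms(2)] show ?thesis .
  qed
  then obtain c where c: "\<And>i. i < n \<Longrightarrow> c i < N"
    "\<And>i i'. i < n \<Longrightarrow> i' < n \<Longrightarrow> i \<noteq> i' \<Longrightarrow> B i (c i) \<inter> B i' (c i') = {}" by blast
  have "separated V E len s n (\<lambda>i. P i (c i))"
    using c con unfolding separated_iff[OF \<open>0 < s\<close>] B_def nbhd_disjoint_iff by blast
  then show ?thesis using c(1) by blast
qed

end

theorem theorem5:
  fixes V :: "'v set" and E :: "('v \<times> 'v) set" and len :: "('v \<times> 'v) \<Rightarrow> real"
    and s :: real and n :: nat and v :: "nat \<Rightarrow> 'v point set \<Rightarrow> real"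
  assumes "graph_ok V E len"
    and "s > 0" and "n \<ge> 1"
    and "\<forall>e\<in>E. len e \<ge> s"
    and "\<forall>x\<in>V. FvsNum (component V E x) E \<le> 1"
    and "\<forall>i<n. valuation V E len (v i)"
  shows "\<exists>A. separated V E len s n A \<and>
     (\<forall>i<n. v i (A i) \<ge> MMS V E len (v i) (min (n + FvsNum V E) (2 * n - 1)) s)"
proof -
  interpret cake V E len by unfold_locales (fact assms(1))
  define N where "N = min (n + FvsNum V E) (2 * n - 1)"
  have "1 \<le> N" using assms(3) by (simp add: N_def)
  then have "\<forall>i. \<exists>Q. i < n \<longrightarrow> separated V E len s N Q \<and> (\<forall>j<N. MMS V E len (v i) N s \<le> v i (Q j))"
    using MMS_attained[OF assms(2)] assms(6) by blast
  then have "\<exists>P. \<forall>i. i < n \<longrightarrow>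
      separated V E len s N (P i) \<and> (\<forall>j<N. MMS V E len (v i) N s \<le> v i (P i j))"
    by (simp only: choice_iff)
  then obtain P where P: "\<And>i. i < n \<Longrightarrow> separated V E len s N (P i)"
    "\<And>i j. i < n \<Longrightarrow> j < N \<Longrightarrow> MMS V E len (v i) N s \<le> v i (P i j)" by blast
  have "\<exists>c. (\<forall>i<n. c i < N) \<and> separated V E len s n (\<lambda>i. P i (c i))"
    using P(1) by (rule separated_rainbow[OF assms(2,3) N_def assms(5)])
  then obtain c where "\<forall>i<n. c i < N" "separated V E len s n (\<lambda>i. P i (c i))" by blast
  then show ?thesis using P(2) unfolding N_def[symmetric]
    by (intro exI[of _ "\<lambda>i. P i (c i)"]) blast
qed

end
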